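(* For any tree with $n$ nodes (rooted, edges directed towards the root) and any assignment of distinct labels from $\{0,1,\dots,n-1\}$ to its nodes, Algorithm BndDTree (a bounded-message algorithm, defined in the context) completes information gathering in time $O(n\log n)$; that is, within $O(n\log n)$ steps, with an absolute implied constant, all rumors are delivered to the root.
   Context: Model (ad-hoc radio network with tree topology). The network is a rooted tree $\mathcal{T}$ with $n$ nodes and root $r$, all edges directed from child to parent. Nodes carry distinct labels from $[n]=\{0,1,\dots,n-1\}$. Each node $v$ initially holds a rumor $\rho_v$; we write $\rho_u$ for the rumor originating at the node with label $u$. Time is discrete, and all nodes start simultaneously. At each step a node is either in the transmit state or in the receive state. If $v$ transmits at step $t$, the message is sent immediately to its parent $w$; $w$ receives it if and only if $w$ is in the receive state at step $t$ and no other child of $w$ transmits at step $t$. If two or more children of $w$ transmit at the same step (a collision), $w$ receives nothing, and neither $w$ nor the senders learn of the collision. A deterministic protocol decides the action of $v$ at time $t$ only from the label of $v$, $t$, and the messages received by $v$ so far ($n$ is known); the tree and the labeling are unknown. Information gathering is complete when every rumor has been delivered to $r$. Bounded messages: no aggregation of rumors is allowed; each message consists of at most one rumor and $O(\log n)$ bits of additional information (such as the label of the node where the rumor originates). 2-height. A leaf has 2-height $0$. For an internal node $v$, let $g$ be the maximum 2-height of a child of $v$; the 2-height of $v$ is $g+1$ if at least two children of $v$ have 2-height $g$, and $g$ otherwise. The nodes of 2-height exactly $h$ form disjoint directed paths. Auxiliary procedure (preprocessing). Each node learns its 2-height, and the 2-heights of its children, in $O(n)$ steps, as follows. First, for $n$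 steps, nodes with labels $0,\dots,n-1$ transmit their labels one at a time, so each node learns its children. Let $\kappa=\lceil n^{1/3}\rceil$ and let $F_0,\dots,F_{m-1}\subseteq[n]$, with $m=O(\kappa^2\log n)$, $m\le n$, be a strong $\kappa$-selective family (for every $X\subseteq[n]$ with $|X|\le\kappa$ and every $x\in X$ some $F_j\cap X=\{x\}$). Steps (renumbered from $0$) are then divided into rounds of three steps, $3s,3s+1,3s+2$. The activation round $\alpha_v$ is $0$ for a leaf, and otherwise is the first round before whose start $v$ has received messages from all its children. For $s=\alpha_v,\dots,\alpha_v+m-1$, $v$ transmits in step $3s+1$, and also in step $3s+2$ if its label is in $F_{s\bmod m}$; for $s=\alpha_v,\dots,\alpha_v+n-1$, $v$ transmits in step $3s$ if its label equals $s\bmod n$; otherwise it receives. The message transmitted by $v$ contains its 2-height, which $v$ can compute from the messages of its children. Algorithm BndDTree. After the preprocessing, let $\ell=\lceil\log n\rceil$ (logarithm base 2). The computation is divided into $\ell+1$ phases $h=0,1,\dots,\ell$, each of $6n$ steps. In phase $h$ only nodes of 2-height $h$ transmit; every node that does not transmit according to the rules below is in the receive state. Phase $h$ has three stages: (1) Parity stage ($n$ steps): each node of 2-height $h$ having no child of 2-height $h$ (the initial node of a path of nodes of 2-height $h$) sends a message along its path, so that each node of the path learns whether it is at an even or odd position on the path. (2) Stage All ($4n$ steps): among nodes of 2-height $h$, even nodes may transmit only in even steps and odd nodes only in odd steps; in each step allotted to it, a node that contains a rumor it has not yet transmitted transmits one such rumor. (3) Stage RR ($n$ steps): in the $u$-th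 step of this stage, $u=0,1,\dots,n-1$, a node of 2-height $h$ that has rumor $\rho_u$ transmits $\rho_u$. *)

theory Defs
  imports Complex_Main "HOL-Library.Landau_Symbols"
begin

section \<open>Rooted trees with labels\<close>

text \<open>A pair \<open>(v, w) \<in> E\<close> is an edge from the child \<open>v\<close> to its parent \<open>w\<close>.\<close>

definition rooted_tree :: "'v set \<Rightarrow> ('v \<times> 'v) set \<Rightarrow> 'v \<Rightarrow> bool" where
  "rooted_tree V E r \<longleftrightarrow>
     finite V \<and> r \<in> V \<and> E \<subseteq> V \<times> V \<and>
     (\<forall>w. (r, w) \<notin> E) \<and>
     (\<forall>v\<in>V - {r}. \<exists>!w. (v, w) \<in> E) \<and>
     (\<forall>v\<in>V. (v, r) \<in> E\<^sup>*)"

definition labelling :: "'v set \<Rightarrow> ('v \<Rightarrow> nat) \<Rightarrow> bool" where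
  "labelling V lab \<longleftrightarrow> inj_on lab V \<and> lab ` V \<subseteq> {0..<card V}"


section \<open>Radio network model with bounded messages\<close>

text \<open>
  The rumor originating at the node labelled \<open>u\<close> is identified with \<open>u\<close>. A message carries at
  most one rumor (\<open>Rumor u\<close>: the rumor together with the label of its origin); the other
  messages carry no rumor:
  \<open>Label u\<close> is sent by node \<open>u\<close> to make itself known to its parent,
  \<open>Height u k\<close> is sent by node \<open>u\<close> of 2-height \<open>k\<close>,
  \<open>Parity b\<close> is sent by a node whose position on its path is even iff \<open>b\<close>.
\<close>

datatype message = Label nat | Height nat nat | Parity bool | Rumor nat

text \<open>
  All numbers in a message are below \<open>n\<close>. There are at most two of them, so that besides the
  rumor itself the message has \<open>O(log n)\<close> bits.
\<close>

fun bounded_message :: "nat \<Rightarrow> message \<Rightarrow> bool" where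
  "bounded_message n (Label u) \<longleftrightarrow> u < n"
| "bounded_message n (Height u k) \<longleftrightarrow> u < n \<and> k < n"
| "bounded_message n (Parity b) \<longleftrightarrow> True"
| "bounded_message n (Rumor u) \<longleftrightarrow> u < n"

text \<open>
  Entry \<open>i\<close> of a history is the message received at step \<open>i\<close>, or \<open>None\<close> if nothing was received.
  The history available at step \<open>t\<close> has length \<open>t\<close>, so a protocol reads the time off the history.
  The action \<open>None\<close> means the receive state, \<open>Some msg\<close> means transmitting \<open>msg\<close>.
\<close>

type_synonym history = "message option list"
type_synonym protocol = "nat \<Rightarrow> history \<Rightarrow> message option"

text \<open>
  What \<open>w\<close> receives in a step with the actions \<open>act\<close>. No distinction is made between a collision
  and silence.
\<close>

definition received :: "('v \<times> 'v) set \<Rightarrow> ('v \<Rightarrow> message option) \<Rightarrow> 'v \<Rightarrow> message option" where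
  "received E act w =
     (if act w = None \<and> (\<exists>!v. (v, w) \<in> E \<and> act v \<noteq> None)
      then act (THE v. (v, w) \<in> E \<and> act v \<noteq> None) else None)"

primrec history_at :: "('v \<times> 'v) set \<Rightarrow> ('v \<Rightarrow> nat) \<Rightarrow> protocol \<Rightarrow> nat \<Rightarrow> 'v \<Rightarrow> history" where
  "history_at E lab P 0 = (\<lambda>v. [])"
| "history_at E lab P (Suc t) =
     (\<lambda>v. history_at E lab P t v @ [received E (\<lambda>u. P (lab u) (history_at E lab P t u)) v])"

definition rumors :: "nat \<Rightarrow> history \<Rightarrow> nat set" where
  "rumors v H = insert v {u. Some (Rumor u) \<in> set H}"

definition gathered ::
  "'v set \<Rightarrow> ('v \<times> 'v) set \<Rightarrow> 'v \<Rightarrow> ('v \<Rightarrow> nat) \<Rightarrow> protocol \<Rightarrow> nat \<Rightarrow> bool" where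
  "gathered V E r lab P t \<longleftrightarrow> (\<forall>v\<in>V. lab v \<in> rumors (lab r) (history_at E lab P t r))"

definition bounded_messages ::
  "'v set \<Rightarrow> ('v \<times> 'v) set \<Rightarrow> ('v \<Rightarrow> nat) \<Rightarrow> protocol \<Rightarrow> bool" where
  "bounded_messages V E lab P \<longleftrightarrow>
     (\<forall>t. \<forall>v\<in>V. \<forall>msg. P (lab v) (history_at E lab P t v) = Some msg \<longrightarrow>
        bounded_message (card V) msg)"


section \<open>Preprocessing: computing 2-heights\<close>

definition strong_selective_family :: "nat \<Rightarrow> nat \<Rightarrow> nat \<Rightarrow> (nat \<Rightarrow> nat set) \<Rightarrow> bool" where
  "strong_selective_family n k m F \<longleftrightarrow>
     (\<forall>j<m. F j \<subseteq> {0..<n}) \<and>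
     (\<forall>X\<subseteq>{0..<n}. card X \<le> k \<longrightarrow> (\<forall>x\<in>X. \<exists>j<m. F j \<inter> X = {x}))"

definition kappa :: "nat \<Rightarrow> nat" where
  "kappa n = nat \<lceil>root 3 (real n)\<rceil>"

text \<open>The 2-height of a node whose children \<open>u \<in> C\<close> have the 2-heights \<open>g u\<close>.\<close>

definition two_height :: "nat set \<Rightarrow> (nat \<Rightarrow> nat) \<Rightarrow> nat" where
  "two_height C g =
     (if C = {} then 0
      else let k = Max (g ` C) in if card {u \<in> C. g u = k} \<ge> 2 then k + 1 else k)"

text \<open>
  In the following, \<open>H\<close> is the history of the node under consideration. The labels of its children
  are those announced in the first \<open>n\<close> steps; only children are ever heard.
\<close>

definition children :: "nat \<Rightarrow> history \<Rightarrow> nat set" where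
  "children n H = {u. Some (Label u) \<in> set (take n H)}"

definition child_height :: "history \<Rightarrow> nat \<Rightarrow> nat" where
  "child_height H u = (THE k. Some (Height u k) \<in> set H)"

definition own_height :: "nat \<Rightarrow> history \<Rightarrow> nat" where
  "own_height n H = two_height (children n H) (child_height H)"

text \<open>
  Round \<open>s\<close> consists of the steps \<open>n + 3 * s\<close>, \<open>n + 3 * s + 1\<close>, \<open>n + 3 * s + 2\<close>.
\<close>

definition heard_all :: "nat \<Rightarrow> history \<Rightarrow> nat \<Rightarrow> bool" where
  "heard_all n H s \<longleftrightarrow>
     (\<forall>u\<in>children n H. \<exists>k. Some (Height u k) \<in> set (take (n + 3 * s) H))"

definition activation_round :: "nat \<Rightarrow> history \<Rightarrow> nat" where
  "activation_round n H = (LEAST s. heard_all n H s)"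

definition height_step ::
  "nat \<Rightarrow> nat \<Rightarrow> (nat \<Rightarrow> nat set) \<Rightarrow> nat \<Rightarrow> history \<Rightarrow> bool" where
  "height_step n m F v H =
     (let s = (length H - n) div 3; i = (length H - n) mod 3; \<alpha> = activation_round n H in
      heard_all n H s \<and>
      (if i = 0 then s < \<alpha> + n \<and> v = s mod n
       else if i = 1 then s < \<alpha> + m
       else s < \<alpha> + m \<and> v \<in> F (s mod m)))"

text \<open>
  Since all nodes must enter phase 0 simultaneously, the preprocessing is given a fixed budget of
  \<open>n\<close> steps followed by \<open>c * n\<close> rounds.
\<close>

definition preprocessing_steps :: "nat \<Rightarrow> nat \<Rightarrow> nat" where
  "preprocessing_steps n c = n + 3 * (c * n)"

definition preprocessing :: "nat \<Rightarrow> nat \<Rightarrow> (nat \<Rightarrow> nat set) \<Rightarrow> protocol" where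
  "preprocessing n m F v H =
     (if length H < n then (if v = length H then Some (Label v) else None)
      else if height_step n m F v H then Some (Height v (own_height n H)) else None)"


section \<open>Phases\<close>

definition last_phase :: "nat \<Rightarrow> nat" where
  "last_phase n = nat \<lceil>log 2 (real n)\<rceil>"

definition phase :: "nat \<Rightarrow> nat \<Rightarrow> history \<Rightarrow> nat" where
  "phase n c H = (length H - preprocessing_steps n c) div (6 * n)"

definition phase_step :: "nat \<Rightarrow> nat \<Rightarrow> history \<Rightarrow> nat" where
  "phase_step n c H = (length H - preprocessing_steps n c) mod (6 * n)"

definition may_transmit :: "nat \<Rightarrow> nat \<Rightarrow> history \<Rightarrow> bool" where
  "may_transmit n c H \<longleftrightarrow>
     length H \<ge> preprocessing_steps n c \<and> phase n c H \<le> last_phase n \<and>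
     own_height n H = phase n c H"

definition initial :: "nat \<Rightarrow> history \<Rightarrow> bool" where
  "initial n H \<longleftrightarrow> (\<forall>u\<in>children n H. child_height H u \<noteq> own_height n H)"

text \<open>
  A node that is not initial learns its parity from the only child of the same 2-height. The initial
  node has position 0.
\<close>

definition parity_message :: "nat \<Rightarrow> nat \<Rightarrow> history \<Rightarrow> message option" where
  "parity_message n c H =
     (if phase_step n c H = 0 then (if initial n H then Some (Parity True) else None)
      else (case last H of Some (Parity b) \<Rightarrow> Some (Parity (\<not> b)) | _ \<Rightarrow> None))"

definition received_in_phase :: "nat \<Rightarrow> nat \<Rightarrow> history \<Rightarrow> message set" where
  "received_in_phase n c H = {msg. Some msg \<in> set (drop (length H - phase_step n c H) H)}"

definition even_position :: "nat \<Rightarrow> nat \<Rightarrow> history \<Rightarrow> bool" where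
  "even_position n c H \<longleftrightarrow> initial n H \<or> Parity False \<in> received_in_phase n c H"

definition odd_position :: "nat \<Rightarrow> nat \<Rightarrow> history \<Rightarrow> bool" where
  "odd_position n c H \<longleftrightarrow> \<not> initial n H \<and> Parity True \<in> received_in_phase n c H"

definition in_stage_all :: "nat \<Rightarrow> nat \<Rightarrow> history \<Rightarrow> bool" where
  "in_stage_all n c H \<longleftrightarrow> n \<le> phase_step n c H \<and> phase_step n c H < 5 * n"

definition allotted :: "nat \<Rightarrow> nat \<Rightarrow> history \<Rightarrow> bool" where
  "allotted n c H \<longleftrightarrow>
     may_transmit n c H \<and> in_stage_all n c H \<and>
     (if even (phase_step n c H - n) then even_position n c H else odd_position n c H)"

text \<open>
  The algorithm leaves open which of its not yet transmitted rumors a node transmits. The choice is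
  made by a function \<open>pick\<close>, which may depend on everything the node knows.
\<close>

type_synonym pick = "nat \<Rightarrow> history \<Rightarrow> nat set \<Rightarrow> nat"

definition picks :: "pick \<Rightarrow> bool" where
  "picks pick \<longleftrightarrow> (\<forall>v H S. S \<noteq> {} \<longrightarrow> pick v H S \<in> S)"

text \<open>The rumor transmitted in a step of Stage All if the rumors in \<open>S\<close> have been transmitted before.\<close>

definition all_choice ::
  "nat \<Rightarrow> nat \<Rightarrow> pick \<Rightarrow> nat \<Rightarrow> nat set \<Rightarrow> history \<Rightarrow> nat option" where
  "all_choice n c pick v S H =
     (if allotted n c H \<and> rumors v H - S \<noteq> {} then Some (pick v H (rumors v H - S)) else None)"

text \<open>
  The rumors transmitted in Stage All during the steps before \<open>t\<close>. A node transmits in a single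
  phase, where Stage RR comes last, so these are all rumors it has transmitted when it takes a step
  of Stage All.
\<close>

primrec transmitted :: "nat \<Rightarrow> nat \<Rightarrow> pick \<Rightarrow> nat \<Rightarrow> history \<Rightarrow> nat \<Rightarrow> nat set" where
  "transmitted n c pick v H 0 = {}"
| "transmitted n c pick v H (Suc t) =
     transmitted n c pick v H t \<union>
     set_option (all_choice n c pick v (transmitted n c pick v H t) (take t H))"

definition stage_all_message :: "nat \<Rightarrow> nat \<Rightarrow> pick \<Rightarrow> protocol" where
  "stage_all_message n c pick v H =
     map_option Rumor (all_choice n c pick v (transmitted n c pick v H (length H)) H)"

definition stage_rr_message :: "nat \<Rightarrow> nat \<Rightarrow> protocol" where
  "stage_rr_message n c v H =
     (let u = phase_step n c H - 5 * n in if u \<in> rumors v H then Some (Rumor u) else None)"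

definition bnd_dtree :: "nat \<Rightarrow> nat \<Rightarrow> nat \<Rightarrow> (nat \<Rightarrow> nat set) \<Rightarrow> pick \<Rightarrow> protocol" where
  "bnd_dtree n c m F pick v H =
     (if length H < preprocessing_steps n c then preprocessing n m F v H
      else if \<not> may_transmit n c H then None
      else if phase_step n c H < n then parity_message n c H
      else if in_stage_all n c H then stage_all_message n c pick v H
      else stage_rr_message n c v H)"

end

theory Submission
  imports Defs "HOL-Real_Asymp.Real_Asymp"
begin

text \<open>
  Write \<open>N v\<close> for the size of the subtree of \<open>v\<close> and \<open>\<kappa>\<close> for \<open>kappa n\<close>. If the last child heard by
  \<open>v\<close> is delayed by more than one round, then a sibling is activated less than \<open>m\<close> rounds before it
  or later; if it is delayed by more than \<open>m\<close> rounds, then this holds for at least \<open>\<kappa>\<close> siblings.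
  Charging the delay to the smallest of the subtrees concerned, which has size at most \<open>N v / 2\<close> or
  \<open>N v / (\<kappa> + 1)\<close>, shows that \<open>v\<close> is activated before round \<open>N v + 2 m a + (m + n) b\<close> for some
  \<open>a\<close>, \<open>b\<close> with \<open>2 ^ a \<le> N v\<close> and \<open>(\<kappa> + 1) ^ b \<le> N v\<close>. Since \<open>n < (\<kappa> + 1)\<^sup>3\<close> and
  \<open>m log n = O(n)\<close>, the preprocessing takes \<open>O(n)\<close> steps.

  In phase \<open>h\<close> the rumors are pipelined along each path of nodes of 2-height \<open>h\<close>, where the parities
  exclude collisions, until the top of the path has all rumors of its subtree. In Stage RR it passes
  them on without collision because sibling subtrees are disjoint. As \<open>2 ^ h \<le> N v\<close> for a node \<open>v\<close>
  of 2-height \<open>h\<close>, there are \<open>O(log n)\<close> phases.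
\<close>

section \<open>Runs of a protocol\<close>

lemma length_history_at [simp]: "length (history_at E lab P t v) = t"
  by (induction t) auto

lemma take_history_at:
  "s \<le> t \<Longrightarrow> take s (history_at E lab P t v) = history_at E lab P s v"
proof (induction t)
  case (Suc t)
  then show ?case by (cases "s = Suc t") auto
qed simp

abbreviation action ::
  "('v \<times> 'v) set \<Rightarrow> ('v \<Rightarrow> nat) \<Rightarrow> protocol \<Rightarrow> nat \<Rightarrow> 'v \<Rightarrow> message option" where
  "action E lab P t v \<equiv> P (lab v) (history_at E lab P t v)"

lemma nth_history_at:
  "s < t \<Longrightarrow> history_at E lab P t v ! s = received E (action E lab P s) v"
  by (induction t) (auto simp: nth_append less_Suc_eq)

lemma set_history_at:
  "msg \<in> set (history_at E lab P t v) \<longleftrightarrow> (\<exists>s<t. received E (action E lab P s) v = msg)"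
  by (auto simp: in_set_conv_nth nth_history_at)

lemma set_drop_history_at:
  assumes "s \<le> t"
  shows "msg \<in> set (drop s (history_at E lab P t v)) \<longleftrightarrow>
    (\<exists>i<t - s. received E (action E lab P (s + i)) v = msg)"
  using assms by (auto simp: in_set_conv_nth nth_history_at)

text \<open>A run up to step \<open>T\<close> consults the protocol only on histories shorter than
  \<open>T\<close>. This identifies the first steps of the full algorithm with a run of the
  preprocessing alone.\<close>

lemma history_at_cong:
  assumes "\<And>v H. length H < T \<Longrightarrow> P v H = Q v H" and "t \<le> T"
  shows "history_at E lab P t = history_at E lab Q t"
  using assms(2)
proof (induction t)
  case (Suc t)
  then show ?case by (simp add: assms(1))
qed simp

lemma received_SomeD:
  assumes "received E act w = Some msg"
  shows "act w = None" and "\<exists>u. (u, w) \<in> E \<and> act u = Some msg"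
proof -
  have *: "act w = None" "\<exists>!v. (v, w) \<in> E \<and> act v \<noteq> None"
    using assms by (auto simp: received_def split: if_splits)
  then show "act w = None" by simp
  have "act (THE v. (v, w) \<in> E \<and> act v \<noteq> None) = Some msg"
    using assms * by (simp add: received_def)
  then show "\<exists>u. (u, w) \<in> E \<and> act u = Some msg"
    using theI'[OF *(2)] by blast
qed

lemma received_SomeI:
  assumes "(u, w) \<in> E" "act u = Some msg" "act w = None"
    and "\<And>u'. (u', w) \<in> E \<Longrightarrow> u' \<noteq> u \<Longrightarrow> act u' = None"
  shows "received E act w = Some msg"
proof -
  have "(THE v. (v, w) \<in> E \<and> act v \<noteq> None) = u"
    using assms by (intro the_equality) (auto, metis option.distinct(1))
  moreover have "\<exists>!v. (v, w) \<in> E \<and> act v \<noteq> None"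
    using assms by (intro ex1I[of _ u]) (auto, metis option.distinct(1))
  ultimately show ?thesis using assms by (simp add: received_def)
qed


section \<open>Labelled trees\<close>

locale labelled_tree =
  fixes V :: "'v set" and E :: "('v \<times> 'v) set" and r :: 'v and lab :: "'v \<Rightarrow> nat" and n :: nat
  assumes tree: "rooted_tree V E r" and labels: "labelling V lab" and n_eq: "n = card V"
begin

definition subtree :: "'v \<Rightarrow> 'v set" where
  "subtree v = {u. (u, v) \<in> E\<^sup>*}"

text \<open>Well-founded recursion along the edges. It goes through labels and
  \<open>inv_into\<close> so that it applies the same function \<open>two_height\<close> that the
  nodes evaluate on what they hear.\<close>

definition height :: "'v \<Rightarrow> nat" where
  "height = wfrec E (\<lambda>f v. two_height (lab ` {u. (u, v) \<in> E}) (\<lambda>l. f (inv_into V lab l)))"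

text \<open>A child sharing the 2-height of its parent is unique, so the nodes counted form the path
  below \<open>v\<close>; counting them avoids an explicit notion of path.\<close>

definition position :: "'v \<Rightarrow> nat" where
  "position v = card {u \<in> subtree v. u \<noteq> v \<and> height u = height v}"

section \<open>Edges, labels and well-foundedness\<close>

lemma finite_V: "finite V" and r_in: "r \<in> V" and E_sub: "E \<subseteq> V \<times> V"
  and no_root_edge: "(r, w) \<notin> E" and reach_root: "v \<in> V \<Longrightarrow> (v, r) \<in> E\<^sup>*"
  using tree by (auto simp: rooted_tree_def)

lemma edge_in: "(u, v) \<in> E \<Longrightarrow> u \<in> V \<and> v \<in> V"
  using E_sub by auto

lemma n_pos: "0 < n"
  using finite_V r_in by (auto simp: n_eq card_gt_0_iff)

lemma inj_lab: "inj_on lab V"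
  using labels by (auto simp: labelling_def)

lemma lab_eq_iff: "u \<in> V \<Longrightarrow> v \<in> V \<Longrightarrow> lab u = lab v \<longleftrightarrow> u = v"
  using inj_lab by (auto simp: inj_on_def)

lemma lab_less: "v \<in> V \<Longrightarrow> lab v < n"
  using labels by (auto simp: labelling_def n_eq)

lemma parent_unique: "(v, w) \<in> E \<Longrightarrow> (v, w') \<in> E \<Longrightarrow> w = w'"
proof -
  assume a: "(v, w) \<in> E" "(v, w') \<in> E"
  have "v \<in> V - {r}" using a no_root_edge E_sub by auto
  then have "\<exists>!w. (v, w) \<in> E" using tree by (auto simp: rooted_tree_def)
  then show ?thesis using a by auto
qed

text \<open>A closed walk from \<open>v\<close> leaves through the unique parent \<open>w\<close>
  and hence yields one at \<open>w\<close>; moving on towards the root, which has no outgoing edge,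
  this becomes impossible.\<close>

lemma acyclic_E: "acyclic E"
proof -
  have "(v, v) \<notin> E\<^sup>+" if "(v, r) \<in> E\<^sup>*" for v
    using that
  proof (induction rule: converse_rtrancl_induct)
    case base
    then show ?case using no_root_edge by (metis converse_tranclE)
  next
    case (step v w)
    show ?case
    proof
      assume "(v, v) \<in> E\<^sup>+"
      then obtain w' where w': "(v, w') \<in> E" "(w', v) \<in> E\<^sup>*"
        by (metis tranclD)
      then have "w' = w" using step parent_unique by blast
      then show False using w' step by (meson rtrancl_into_trancl1)
    qed
  qed
  moreover have "v \<in> V" if "(v, v) \<in> E\<^sup>+" for v
    using that edge_in by (meson tranclD)
  ultimately show ?thesis using reach_root unfolding acyclic_def by blast
qed

lemma finite_E: "finite E"
  using E_sub finite_V finite_subset by blast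

lemma wf_E: "wf E"
  using finite_E acyclic_E by (rule finite_acyclic_wf)

lemma finite_children: "finite {u. (u, v) \<in> E}"
  by (rule finite_subset[OF _ finite_V]) (use edge_in in auto)

section \<open>Subtrees and their sizes\<close>

lemma subtree_sub: "v \<in> V \<Longrightarrow> subtree v \<subseteq> V"
  unfolding subtree_def using edge_in by (auto elim: converse_rtranclE)

lemma finite_subtree: "v \<in> V \<Longrightarrow> finite (subtree v)"
  using subtree_sub finite_V finite_subset by blast

lemma self_in_subtree: "v \<in> subtree v"
  by (simp add: subtree_def)

lemma subtree_root: "subtree r = V"
  using subtree_sub[OF r_in] reach_root by (auto simp: subtree_def)

lemma subtree_unfold: "subtree v = insert v (\<Union>u\<in>{u. (u, v) \<in> E}. subtree u)"
  by (auto simp: subtree_def elim: rtranclE intro: rtrancl_into_rtrancl)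

lemma self_notin_subtree_child: "(u, v) \<in> E \<Longrightarrow> v \<notin> subtree u"
  using acyclic_E unfolding subtree_def acyclic_def
  by (auto dest: rtrancl_into_trancl1)

text \<open>Parents are unique, so the ancestors of a common element form a chain and one of
  \<open>u\<close>, \<open>u'\<close> would reach the other. The walk between them starts with the
  edge to \<open>v\<close>, which would put \<open>v\<close> below its own child.\<close>

lemma subtree_disjoint:
  assumes "(u, v) \<in> E" "(u', v) \<in> E" "u \<noteq> u'"
  shows "subtree u \<inter> subtree u' = {}"
proof -
  have ordered: False if uu: "(a, v) \<in> E" "(b, v) \<in> E" "a \<noteq> b" "(a, b) \<in> E\<^sup>*" for a b
  proof -
    obtain w where w: "(a, w) \<in> E" "(w, b) \<in> E\<^sup>*"
      using uu by (metis converse_rtranclE)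
    then have "w = v" using uu parent_unique by blast
    then show False using w uu self_notin_subtree_child by (auto simp: subtree_def)
  qed
  have "single_valued E" using parent_unique by (auto simp: single_valued_def)
  show ?thesis
  proof (rule ccontr)
    assume "subtree u \<inter> subtree u' \<noteq> {}"
    then obtain x where "(x, u) \<in> E\<^sup>*" "(x, u') \<in> E\<^sup>*" by (auto simp: subtree_def)
    then have "(u, u') \<in> E\<^sup>* \<or> (u', u) \<in> E\<^sup>*"
      using \<open>single_valued E\<close> single_valued_confluent by metis
    then show False using ordered assms by blast
  qed
qed

lemma sum_card_subtree_less:
  assumes "X \<subseteq> {u. (u, v) \<in> E}" "v \<in> V"
  shows "(\<Sum>u\<in>X. card (subtree u)) < card (subtree v)"
proof -
  have fin: "finite X" using assms finite_children finite_subset by blast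
  have "(\<Sum>u\<in>X. card (subtree u)) = card (\<Union>u\<in>X. subtree u)"
    using assms fin subtree_disjoint finite_subtree edge_in
    by (intro card_UN_disjoint[symmetric]) blast+
  also have "\<dots> < card (subtree v)"
  proof (intro psubset_card_mono finite_subtree)
    show "(\<Union>u\<in>X. subtree u) \<subset> subtree v"
      using assms self_notin_subtree_child self_in_subtree[of v] subtree_unfold[of v] by blast
  qed (use assms in auto)
  finally show ?thesis .
qed

lemma card_child_subtree: "(u, v) \<in> E \<Longrightarrow> card (subtree u) < card (subtree v)"
  using sum_card_subtree_less[of "{u}" v] edge_in by auto

text \<open>Averaging over disjoint subtrees. It is used with 2 for the bound on 2-heights and with
  one more than the selectivity for the delays.\<close>

lemma exists_small_child_subtree:
  assumes "X \<subseteq> {u. (u, v) \<in> E}" "v \<in> V" "X \<noteq> {}" "k \<le> card X"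
  shows "\<exists>u\<in>X. k * card (subtree u) \<le> card (subtree v)"
proof (rule ccontr)
  assume *: "\<not> ?thesis"
  let ?s = "\<lambda>u. card (subtree u)"
  have fin: "finite X" using assms finite_children finite_subset by blast
  define u where "u = arg_min_on ?s X"
  have u: "u \<in> X" "\<And>w. w \<in> X \<Longrightarrow> ?s u \<le> ?s w"
    using arg_min_if_finite[OF fin assms(3), of ?s] unfolding u_def
    by (auto simp: not_less)
  have "k * ?s u \<le> card X * ?s u" using assms by simp
  also have "\<dots> \<le> (\<Sum>w\<in>X. ?s w)"
    using sum_bounded_below[of X "?s u" ?s] u by simp
  also have "\<dots> < ?s v" using sum_card_subtree_less assms by blast
  finally show False using * u by auto
qed

section \<open>2-heights\<close>

lemma height_unfold:
  "height v = two_height (lab ` {u. (u, v) \<in> E}) (\<lambda>l. height (inv_into V lab l))"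
proof -
  \<comment> \<open>\<open>two_height\<close> looks at its second argument only on the given set, so
    the cut-off made by \<open>wfrec\<close> is invisible.\<close>
  have cong: "two_height C f = two_height C f'" if "\<And>l. l \<in> C \<Longrightarrow> f l = f' l" for C f f'
  proof -
    have "f ` C = f' ` C" "\<And>k. {u \<in> C. f u = k} = {u \<in> C. f' u = k}" using that by auto
    then show ?thesis by (simp add: two_height_def)
  qed
  show ?thesis
    unfolding height_def
    by (subst wfrec[OF wf_E], rule cong) (auto simp: cut_apply inv_into_f_f[OF inj_lab] edge_in)
qed

lemma height_eq:
  "height v = (if {u. (u, v) \<in> E} = {} then 0
     else let k = Max (height ` {u. (u, v) \<in> E}) in
       if card {u. (u, v) \<in> E \<and> height u = k} \<ge> 2 then k + 1 else k)"
proof -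
  let ?C = "{u. (u, v) \<in> E}"
  let ?g = "\<lambda>l. height (inv_into V lab l)"
  have sub: "?C \<subseteq> V" using edge_in by auto
  have g: "?g (lab u) = height u" if "u \<in> ?C" for u
    using that sub inj_lab by (auto simp: inv_into_f_f)
  have img: "?g ` lab ` ?C = height ` ?C"
    unfolding image_image using g by (intro image_cong) auto
  have "{l \<in> lab ` ?C. ?g l = k} = lab ` {u \<in> ?C. height u = k}" for k
    using g by auto
  moreover have "inj_on lab {u \<in> ?C. height u = k}" for k
    by (rule inj_on_subset[OF inj_lab]) (use sub in auto)
  ultimately have "card {l \<in> lab ` ?C. ?g l = k} = card {u \<in> ?C. height u = k}" for k
    by (simp add: card_image)
  then show ?thesis
    by (subst height_unfold) (simp add: two_height_def img)
qed

lemma height_child_le: "(u, v) \<in> E \<Longrightarrow> height u \<le> height v"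
proof -
  assume e: "(u, v) \<in> E"
  have "height u \<le> Max (height ` {u. (u, v) \<in> E})"
    using e finite_children by (intro Max_ge) auto
  also have "\<dots> \<le> height v"
    using e height_eq[of v] by (auto simp: Let_def split: if_splits)
  finally show ?thesis .
qed

text \<open>Two such children would both attain the maximum, and \<open>v\<close> would have a
  larger 2-height. Hence nodes of equal 2-height are arranged in paths.\<close>

lemma same_height_child_unique:
  assumes "(u, v) \<in> E" "(u', v) \<in> E" "height u = height v" "height u' = height v"
  shows "u = u'"
proof (rule ccontr)
  assume ne: "u \<noteq> u'"
  let ?k = "Max (height ` {u. (u, v) \<in> E})"
  let ?X = "{u. (u, v) \<in> E \<and> height u = ?k}"
  have "height u \<le> ?k"
    using assms(1) finite_children by (intro Max_ge) auto
  then have le: "height v \<le> ?k" using assms(3) by simp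
  have hv: "height v = (if card ?X \<ge> 2 then ?k + 1 else ?k)"
    using assms height_eq[of v] by (auto simp: Let_def)
  then have k: "height v = ?k" and card: "card ?X < 2"
    using le assms by (auto split: if_splits)
  have "card {u, u'} \<le> card ?X"
    using assms k finite_children by (intro card_mono) auto
  then show False using ne card by simp
qed

text \<open>The 2-height rises only when two children attain the maximum, and then one of their
  subtrees has at most half the size.\<close>

lemma two_power_height_le: "v \<in> V \<Longrightarrow> 2 ^ height v \<le> card (subtree v)"
proof (induction v rule: wf_induct_rule[OF wf_E])
  case (1 v)
  let ?C = "{u. (u, v) \<in> E}"
  let ?k = "Max (height ` ?C)"
  let ?X = "{u. (u, v) \<in> E \<and> height u = ?k}"
  show ?case
  proof (cases "?C = {}")
    case True
    then show ?thesis using self_in_subtree[of v] finite_subtree[OF 1(2)]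
      by (subst height_eq) (auto simp: Suc_le_eq card_gt_0_iff)
  next
    case False
    have "?k \<in> height ` ?C" using False finite_children by (intro Max_in) auto
    then have ne: "?X \<noteq> {}" by auto
    have X: "?X \<subseteq> ?C" by auto
    have hv: "height v = (if card ?X \<ge> 2 then ?k + 1 else ?k)"
      using False height_eq[of v] by (auto simp: Let_def)
    have IH: "2 ^ ?k \<le> card (subtree u)" if "u \<in> ?X" for u
      using that 1 edge_in by fastforce
    show ?thesis
    proof (cases "card ?X \<ge> 2")
      case True
      then obtain u where u: "u \<in> ?X" "2 * card (subtree u) \<le> card (subtree v)"
        using exists_small_child_subtree[OF X 1(2) ne] by blast
      then show ?thesis using IH[OF u(1)] hv True by simp
    next
      case False
      obtain u where u: "u \<in> ?X" using ne by blast
      then have "card (subtree u) < card (subtree v)" using card_child_subtree by auto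
      then show ?thesis using IH[OF u] hv False by simp
    qed
  qed
qed

lemma two_power_height_le_n: "v \<in> V \<Longrightarrow> 2 ^ height v \<le> n"
  using two_power_height_le[of v] card_mono[OF finite_V subtree_sub, of v] by (simp add: n_eq)

lemma height_less: "v \<in> V \<Longrightarrow> height v < n"
  using two_power_height_le_n[of v] less_exp[of "height v"] by linarith

lemma height_le_last_phase: "v \<in> V \<Longrightarrow> height v \<le> last_phase n"
proof -
  assume v: "v \<in> V"
  have "real (height v) \<le> log 2 (real n)"
    using le_log2_of_power[OF two_power_height_le_n[OF v]] .
  then show ?thesis unfolding last_phase_def by linarith
qed

section \<open>Positions on the paths of equal 2-height\<close>

lemma height_subtree_le: "u \<in> subtree v \<Longrightarrow> height u \<le> height v"
  unfolding subtree_def mem_Collect_eq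
  by (induction rule: rtrancl_induct) (auto dest: height_child_le)

lemma position_less: "v \<in> V \<Longrightarrow> position v < n"
proof -
  assume v: "v \<in> V"
  have "{u \<in> subtree v. u \<noteq> v \<and> height u = height v} \<subset> V"
    using subtree_sub[OF v] v by auto
  then show ?thesis unfolding position_def n_eq by (rule psubset_card_mono[OF finite_V])
qed

lemma position_initial:
  assumes "\<And>u. (u, v) \<in> E \<Longrightarrow> height u \<noteq> height v"
  shows "position v = 0"
proof -
  have "{u \<in> subtree v. u \<noteq> v \<and> height u = height v} = {}"
    using assms height_child_le height_subtree_le subtree_unfold[of v]
    by (fastforce dest: le_antisym)
  then show ?thesis unfolding position_def by (metis card.empty)
qed

lemma position_step:
  assumes "(u, v) \<in> E" "height u = height v"
  shows "position v = Suc (position u)"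
proof -
  let ?S = "{w \<in> subtree u. w \<noteq> u \<and> height w = height u}"
  have "{w \<in> subtree v. w \<noteq> v \<and> height w = height v} = insert u ?S" (is "?L = ?R")
  proof
    show "?R \<subseteq> ?L"
      using assms self_notin_subtree_child[OF assms(1)] subtree_unfold[of v] self_in_subtree
      by auto
    show "?L \<subseteq> ?R"
    proof
      fix w assume w: "w \<in> ?L"
      then obtain u' where u': "(u', v) \<in> E" "w \<in> subtree u'"
        using subtree_unfold[of v] by auto
      \<comment> \<open>2-heights do not decrease towards the root, and that of \<open>u'\<close>
        lies between two equal values.\<close>
      have "height u' = height v"
        using height_subtree_le[OF u'(2)] height_child_le[OF u'(1)] w by simp
      then have "u' = u" using same_height_child_unique assms u' by blast
      then show "w \<in> ?R" using u' w assms by auto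
    qed
  qed
  moreover have "finite ?S" using finite_subtree edge_in assms by auto
  ultimately show ?thesis by (simp add: position_def)
qed

end

text \<open>Correctness of a node's computation from true and complete announcements, for an
  arbitrary history because it serves both the preprocessing alone and the full algorithm.\<close>

lemma (in labelled_tree) own_height_correct:
  assumes "v \<in> V" and ch: "children n H = lab ` {c. (c, v) \<in> E}"
    and corr: "\<And>x k. Some (Height x k) \<in> set H \<Longrightarrow> \<exists>c. (c, v) \<in> E \<and> x = lab c \<and> k = height c"
    and all: "\<And>c. (c, v) \<in> E \<Longrightarrow> \<exists>k. Some (Height (lab c) k) \<in> set H"
  shows "(c, v) \<in> E \<Longrightarrow> child_height H (lab c) = height c" and "own_height n H = height v"
proof -
  have *: "child_height H (lab c) = height c" if c: "(c, v) \<in> E" for c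
  proof -
    have "k = height c" if "Some (Height (lab c) k) \<in> set H" for k
      using corr[OF that] c edge_in lab_eq_iff by metis
    then show ?thesis using all[OF c] unfolding child_height_def by (metis the_equality)
  qed
  then show "(c, v) \<in> E \<Longrightarrow> child_height H (lab c) = height c" .
  have eq: "child_height H l = height (inv_into V lab l)" if "l \<in> children n H" for l
    using that * edge_in inj_lab by (auto simp: ch inv_into_f_f)
  then have "child_height H ` children n H = (\<lambda>l. height (inv_into V lab l)) ` children n H"
    and "\<And>k. {u \<in> children n H. child_height H u = k} =
      {u \<in> children n H. height (inv_into V lab u) = k}"
    by auto
  then show "own_height n H = height v"
    by (subst height_unfold) (simp add: own_height_def two_height_def ch)
qed


section \<open>Preprocessing\<close>

locale preprocessing_run = labelled_tree V E r lab n
  for V :: "'v set" and E :: "('v \<times> 'v) set" and r :: 'v and lab :: "'v \<Rightarrow> nat" and n :: nat +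
  fixes m k :: nat and F :: "nat \<Rightarrow> nat set"
  assumes selective: "strong_selective_family n k m F" and k_pos: "0 < k"
begin

abbreviation hist :: "nat \<Rightarrow> 'v \<Rightarrow> history" where
  "hist t v \<equiv> history_at E lab (preprocessing n m F) t v"

abbreviation act :: "nat \<Rightarrow> 'v \<Rightarrow> message option" where
  "act t v \<equiv> action E lab (preprocessing n m F) t v"

text \<open>\<open>heard\<close>, \<open>ready\<close> and \<open>activation\<close> describe the
  run from outside, with nodes and true 2-heights. They are the counterparts of
  \<open>heard_all\<close> and \<open>activation_round\<close>, which a node reads off its own
  history.\<close>

definition heard :: "'v \<Rightarrow> 'v \<Rightarrow> nat \<Rightarrow> bool" where
  "heard v c s \<longleftrightarrow> (\<exists>t<n + 3 * s. received E (act t) v = Some (Height (lab c) (height c)))"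

definition ready :: "'v \<Rightarrow> nat \<Rightarrow> bool" where
  "ready v s \<longleftrightarrow> (\<forall>c. (c, v) \<in> E \<longrightarrow> heard v c s)"

definition activation :: "'v \<Rightarrow> nat" where
  "activation v = (LEAST s. ready v s)"

lemma m_pos: "0 < m"
proof -
  \<comment> \<open>A singleton has size at most \<open>k\<close>, so the family must have a
    member.\<close>
  have "{0} \<subseteq> {0..<n}" "card {0::nat} \<le> k" using n_pos k_pos by auto
  then have "\<exists>j<m. F j \<inter> {0} = {0}"
    using selective unfolding strong_selective_family_def by blast
  then obtain j where "j < m" by blast
  then show ?thesis by simp
qed

lemma heard_mono: "heard v c s \<Longrightarrow> s \<le> s' \<Longrightarrow> heard v c s'"
  unfolding heard_def by (meson add_left_mono mult_le_mono2 order_less_le_trans)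

lemma ready_mono: "ready v s \<Longrightarrow> s \<le> s' \<Longrightarrow> ready v s'"
  unfolding ready_def using heard_mono by blast

lemma ready_activation: "ready v s \<Longrightarrow> ready v (activation v)"
  unfolding activation_def by (rule LeastI)

lemma activation_le: "ready v s \<Longrightarrow> activation v \<le> s"
  unfolding activation_def by (rule Least_le)

section \<open>Announced labels and 2-heights\<close>

lemma act_label: "t < n \<Longrightarrow> act t v = (if lab v = t then Some (Label t) else None)"
  by (simp add: preprocessing_def)

lemma act_height_step:
  "n \<le> t \<Longrightarrow> act t v =
    (if height_step n m F (lab v) (hist t v)
     then Some (Height (lab v) (own_height n (hist t v))) else None)"
  by (subst preprocessing_def) simp

lemma act_later: "n \<le> t \<Longrightarrow> act t v = Some msg \<Longrightarrow> \<exists>k. msg = Height (lab v) k"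
  by (auto simp: act_height_step split: if_splits)

lemma received_label:
  assumes "(c, v) \<in> E"
  shows "received E (act (lab c)) v = Some (Label (lab c))"
proof -
  have "lab c < n" "c \<noteq> v"
    using assms edge_in lab_less self_notin_subtree_child[OF assms] self_in_subtree by auto
  then show ?thesis using assms edge_in lab_eq_iff
    by (intro received_SomeI[of c]) (auto simp: act_label)
qed

lemma children_correct:
  assumes "n \<le> t"
  shows "children n (hist t v) = lab ` {c. (c, v) \<in> E}"
proof -
  have "(\<exists>s<n. received E (act s) v = Some (Label x)) \<longleftrightarrow> (\<exists>c. (c, v) \<in> E \<and> x = lab c)" for x
  proof
    assume "\<exists>s<n. received E (act s) v = Some (Label x)"
    then obtain s where "s < n" "received E (act s) v = Some (Label x)" by auto
    then show "\<exists>c. (c, v) \<in> E \<and> x = lab c"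
      using received_SomeD(2)[of E "act s" v] act_label by (fastforce split: if_splits)
  qed (use received_label lab_less edge_in in blast)
  then show ?thesis using assms
    by (auto simp: children_def take_history_at set_history_at)
qed

text \<open>Induction from the leaves: a node transmits a 2-height only after hearing all its
  children, whose announcements are correct by the induction hypothesis.\<close>

lemma act_height:
  "v \<in> V \<Longrightarrow> act t v = Some (Height x j) \<Longrightarrow> x = lab v \<and> j = height v"
proof (induction v arbitrary: t x j rule: wf_induct_rule[OF wf_E])
  case (1 v)
  have t: "n \<le> t" using 1(3) act_label[of t v] by (cases "t < n") (auto split: if_splits)
  have "height_step n m F (lab v) (hist t v)"
    and xj: "x = lab v" "j = own_height n (hist t v)"
    using 1(3) act_height_step[OF t] by (auto split: if_splits)
  then have "heard_all n (hist t v) ((t - n) div 3)"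
    by (simp add: height_step_def Let_def)
  then have all: "\<exists>k. Some (Height (lab c) k) \<in> set (hist t v)" if "(c, v) \<in> E" for c
    using that t by (auto simp: heard_all_def children_correct dest: in_set_takeD)
  have "\<exists>c. (c, v) \<in> E \<and> y = lab c \<and> i = height c"
    if yi: "Some (Height y i) \<in> set (hist t v)" for y i
  proof -
    obtain i' where "received E (act i') v = Some (Height y i)"
      using yi unfolding set_history_at by blast
    from received_SomeD(2)[OF this]
    obtain c where c: "(c, v) \<in> E" "act i' c = Some (Height y i)" by (elim exE conjE)
    have "c \<in> V" using c(1) edge_in by simp
    then show ?thesis using 1(1)[OF c(1) _ c(2)] c(1) by (intro exI[of _ c]) simp
  qed
  then show ?case
    using own_height_correct(2)[OF 1(2) children_correct[OF t]] all xj by blast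
qed

lemma received_height:
  assumes "received E (act t) v = Some (Height x j)"
  shows "\<exists>c. (c, v) \<in> E \<and> x = lab c \<and> j = height c"
proof -
  from received_SomeD(2)[OF assms]
  obtain c where c: "(c, v) \<in> E" "act t c = Some (Height x j)" by (elim exE conjE)
  then have "c \<in> V" using edge_in by simp
  then show ?thesis using act_height[OF _ c(2)] c(1) by (intro exI[of _ c]) simp
qed

lemma heard_all_iff_ready:
  assumes "n + 3 * s \<le> t"
  shows "heard_all n (hist t v) s \<longleftrightarrow> ready v s"
proof -
  have "(\<exists>j. Some (Height (lab c) j) \<in> set (hist (n + 3 * s) v)) \<longleftrightarrow> heard v c s"
    if "(c, v) \<in> E" for c
  proof
    assume "\<exists>j. Some (Height (lab c) j) \<in> set (hist (n + 3 * s) v)"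
    then obtain i j where i: "i < n + 3 * s" "received E (act i) v = Some (Height (lab c) j)"
      by (auto simp: set_history_at)
    then obtain c' where "(c', v) \<in> E" "lab c = lab c'" "j = height c'"
      using received_height by blast
    then show "heard v c s" using i that edge_in lab_eq_iff unfolding heard_def by metis
  qed (auto simp: heard_def set_history_at)
  then show ?thesis using assms
    by (auto simp: heard_all_def ready_def children_correct take_history_at)
qed

lemma own_height_ready:
  assumes "v \<in> V" "ready v s" "n + 3 * s \<le> t"
  shows "own_height n (hist t v) = height v"
proof (rule own_height_correct(2)[OF assms(1)])
  show "children n (hist t v) = lab ` {c. (c, v) \<in> E}"
    using assms by (intro children_correct) simp
  show "\<exists>c. (c, v) \<in> E \<and> x = lab c \<and> j = height c"
    if "Some (Height x j) \<in> set (hist t v)" for x j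
    using that received_height by (auto simp: set_history_at)
  show "\<exists>j. Some (Height (lab c) j) \<in> set (hist t v)" if "(c, v) \<in> E" for c
    using that assms unfolding ready_def heard_def set_history_at
    by (meson order_less_le_trans)
qed

text \<open>Once \<open>v\<close> is ready, its history covers all rounds up to its activation, so
  the least round found there is the true one.\<close>

lemma activation_round_eq:
  assumes "ready v s" "n + 3 * s \<le> t"
  shows "activation_round n (hist t v) = activation v"
  unfolding activation_round_def
proof (rule Least_equality)
  have le: "activation v \<le> s" using activation_le assms by blast
  show "heard_all n (hist t v) (activation v)"
    using ready_activation[OF assms(1)] heard_all_iff_ready[of "activation v" t v] le assms(2)
    by simp
  fix y assume y: "heard_all n (hist t v) y"
  show "activation v \<le> y"
  proof (rule ccontr)
    assume "\<not> activation v \<le> y"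
    then have "n + 3 * y \<le> t" using le assms(2) by linarith
    then show False
      using y heard_all_iff_ready activation_le \<open>\<not> activation v \<le> y\<close> by blast
  qed
qed

text \<open>The rule of the protocol with its references to the history replaced by
  \<open>ready\<close>, \<open>activation\<close> and the true 2-height; the timing arguments below
  rest on this form.\<close>

lemma act_round:
  assumes "v \<in> V" "i < 3"
  shows "act (n + 3 * s + i) v =
    (if ready v s \<and>
      (if i = 0 then s < activation v + n \<and> lab v = s mod n
       else if i = 1 then s < activation v + m
       else s < activation v + m \<and> lab v \<in> F (s mod m))
     then Some (Height (lab v) (height v)) else None)"
proof -
  define t where "t = n + 3 * s + i"
  have s: "n \<le> t" "(t - n) div 3 = s" "(t - n) mod 3 = i" and le: "n + 3 * s \<le> t"
    using assms(2) by (auto simp: t_def add.assoc)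
  have ha: "heard_all n (hist t v) s \<longleftrightarrow> ready v s" by (rule heard_all_iff_ready[OF le])
  show ?thesis
    unfolding t_def[symmetric]
  proof (cases "ready v s")
    case True
    have act: "activation_round n (hist t v) = activation v" "own_height n (hist t v) = height v"
      using activation_round_eq[OF True le] own_height_ready[OF assms(1) True le] .
    show "act t v = (if ready v s \<and>
      (if i = 0 then s < activation v + n \<and> lab v = s mod n
       else if i = 1 then s < activation v + m
       else s < activation v + m \<and> lab v \<in> F (s mod m))
     then Some (Height (lab v) (height v)) else None)"
      unfolding act_height_step[OF s(1)] act height_step_def length_history_at s Let_def ha ..
  next
    case False
    then have "\<not> height_step n m F (lab v) (hist t v)"
      unfolding height_step_def length_history_at s Let_def ha by blast
    then show "act t v = (if ready v s \<and>
      (if i = 0 then s < activation v + n \<and> lab v = s mod n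
       else if i = 1 then s < activation v + m
       else s < activation v + m \<and> lab v \<in> F (s mod m))
     then Some (Height (lab v) (height v)) else None)"
      unfolding act_height_step[OF s(1)] using False by (simp only: if_False simp_thms)
  qed
qed

section \<open>Delays and activation rounds\<close>

lemma heard_alone:
  assumes e: "(c, v) \<in> E" and "i < 3" and a: "act (n + 3 * s + i) c \<noteq> None"
    and other: "\<And>u. (u, v) \<in> E \<Longrightarrow> u \<noteq> c \<Longrightarrow> act (n + 3 * s + i) u = None"
  shows "heard v c (Suc s)"
proof (cases "ready v s")
  \<comment> \<open>A ready parent may be transmitting and miss the message, but then it has already
    heard \<open>c\<close>.\<close>
  case True
  then show ?thesis using e heard_mono ready_def by (meson le_Suc_eq order_refl)
next
  case False
  have c: "c \<in> V" and v: "v \<in> V" using e edge_in by auto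
  have "act (n + 3 * s + i) c = Some (Height (lab c) (height c))"
    using a act_round[OF c \<open>i < 3\<close>, of s] by (auto split: if_splits)
  moreover have "act (n + 3 * s + i) v = None"
    using False act_round[OF v \<open>i < 3\<close>, of s] by simp
  ultimately have "received E (act (n + 3 * s + i)) v = Some (Height (lab c) (height c))"
    using e other by (intro received_SomeI) auto
  then show ?thesis
    unfolding heard_def using \<open>i < 3\<close> by (intro exI[of _ "n + 3 * s + i"]) auto
qed

text \<open>Among any \<open>n\<close> consecutive rounds one belongs to the label of
  \<open>c\<close> alone, as siblings have different labels.\<close>

lemma heard_round_robin:
  assumes e: "(c, v) \<in> E" and rdy: "ready c s"
  shows "heard v c (activation c + n)"
proof -
  have c: "c \<in> V" using e edge_in by auto
  let ?a = "activation c"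
  obtain s where s: "?a \<le> s" "s < ?a + n" "s mod n = lab c"
  proof -
    \<comment> \<open>The first round from the activation on that is congruent to the label of
      \<open>c\<close> modulo \<open>n\<close>.\<close>
    define s where "s = ?a + (lab c + n - ?a mod n) mod n"
    have "?a mod n < n" using n_pos by simp
    have "s mod n = (?a mod n + (lab c + n - ?a mod n)) mod n"
      unfolding s_def by (simp add: mod_add_right_eq mod_add_left_eq)
    also have "?a mod n + (lab c + n - ?a mod n) = lab c + n"
      using \<open>?a mod n < n\<close> by simp
    finally have "s mod n = lab c" using lab_less[OF c] by simp
    then show thesis using that[of s] n_pos by (simp add: s_def)
  qed
  have "heard v c (Suc s)"
  proof (rule heard_alone[OF e, where i = 0])
    show "act (n + 3 * s + 0) c \<noteq> None"
      using act_round[OF c, of 0 s] s ready_mono[OF ready_activation[OF rdy]] by simp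
    show "act (n + 3 * s + 0) u = None" if "(u, v) \<in> E" "u \<noteq> c" for u
    proof -
      have "u \<in> V" "lab u \<noteq> lab c" using that c edge_in lab_eq_iff by auto
      then show ?thesis using act_round[of u 0 s] s by simp
    qed
  qed simp
  then show ?thesis using s by (elim heard_mono) auto
qed

text \<open>Only siblings whose windows of \<open>m\<close> rounds overlap that of \<open>c\<close>
  can disturb it in the last step of a round. With \<open>c\<close> included they are at most
  \<open>k\<close>, so some set of the family isolates \<open>c\<close> within its window.\<close>

lemma heard_selective:
  assumes e: "(c, v) \<in> E" and rdy: "ready c s"
    and card: "card {u. (u, v) \<in> E \<and> activation u < activation c + m \<and>
      activation c < activation u + m} \<le> k" (is "card ?X \<le> k")
  shows "heard v c (activation c + m)"
proof -
  have c: "c \<in> V" using e edge_in by auto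
  let ?a = "activation c"
  have V: "?X \<subseteq> V" using edge_in by auto
  have inj: "inj_on lab ?X" by (rule inj_on_subset[OF inj_lab V])
  have "lab ` ?X \<subseteq> {0..<n}" using V lab_less by auto
  moreover have "card (lab ` ?X) \<le> k" using card card_image[OF inj] by simp
  moreover have cX: "c \<in> ?X" using e m_pos by simp
  ultimately obtain j where j: "j < m" "F j \<inter> lab ` ?X = {lab c}"
    using selective unfolding strong_selective_family_def by blast
  obtain s where s: "?a \<le> s" "s < ?a + m" "s mod m = j"
  proof -
    define s where "s = ?a + (j + m - ?a mod m) mod m"
    have "?a mod m < m" using m_pos by simp
    have "s mod m = (?a mod m + (j + m - ?a mod m)) mod m"
      unfolding s_def by (simp add: mod_add_right_eq mod_add_left_eq)
    also have "?a mod m + (j + m - ?a mod m) = j + m"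
      using \<open>?a mod m < m\<close> by simp
    finally have "s mod m = j" using j by simp
    then show thesis using that[of s] m_pos by (simp add: s_def)
  qed
  have "heard v c (Suc s)"
  proof (rule heard_alone[OF e, where i = 2])
    show "act (n + 3 * s + 2) c \<noteq> None"
      using act_round[OF c, of 2 s] s j ready_mono[OF ready_activation[OF rdy]] by auto
    show "act (n + 3 * s + 2) u = None" if u: "(u, v) \<in> E" "u \<noteq> c" for u
    proof (rule ccontr)
      assume "act (n + 3 * s + 2) u \<noteq> None"
      then have *: "ready u s" "s < activation u + m" "lab u \<in> F j"
        using act_round[of u 2 s] edge_in[OF u(1)] s by (auto split: if_splits)
      then have "u \<in> ?X" using u s activation_le[OF *(1)] by simp
      then have "lab u = lab c" using j * by blast
      then show False using u c edge_in lab_eq_iff by auto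
    qed
  qed simp
  then show ?thesis using s by (elim heard_mono) auto
qed

text \<open>The exponents count how often a delay is charged to a subtree smaller by a factor 2, at
  cost \<open>2 * m\<close>, or \<open>k + 1\<close>, at cost \<open>m + n\<close>. The size term
  pays for delays of a single round.\<close>

definition timely :: "'v \<Rightarrow> nat \<Rightarrow> bool" where
  "timely v s \<longleftrightarrow> (\<exists>a b. 2 ^ a \<le> card (subtree v) \<and> (k + 1) ^ b \<le> card (subtree v) \<and>
     s < card (subtree v) + 2 * m * a + (m + n) * b)"

lemma heard_timely:
  assumes e: "(c, v) \<in> E"
    and IH: "\<And>u. (u, v) \<in> E \<Longrightarrow> ready u (activation u) \<and> timely u (activation u)"
  shows "\<exists>s. heard v c s \<and> timely v s"
proof -
  have c: "c \<in> V" and v: "v \<in> V" using e edge_in by auto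
  let ?N = "\<lambda>u. card (subtree u)"
  let ?a = "activation c"
  have N: "?N c < ?N v" using card_child_subtree[OF e] .
  obtain a b where ab: "2 ^ a \<le> ?N c" "(k + 1) ^ b \<le> ?N c" "?a < ?N c + 2 * m * a + (m + n) * b"
    using IH[OF e] unfolding timely_def by blast
  let ?X = "{u. (u, v) \<in> E \<and> activation u < activation c + m \<and> activation c < activation u + m}"
  have rdy: "ready c ?a" using IH e by blast
  \<comment> \<open>Either no sibling transmits in the middle step of the activation round of
    \<open>c\<close>, or one does and at most \<open>k\<close> windows overlap that of
    \<open>c\<close>, or more than \<open>k\<close> do.\<close>
  consider (alone) "\<And>u. (u, v) \<in> E \<Longrightarrow> u \<noteq> c \<Longrightarrow> act (n + 3 * ?a + 1) u = None"
    | (few) w where "(w, v) \<in> E" "w \<noteq> c" "act (n + 3 * ?a + 1) w \<noteq> None" "card ?X \<le> k"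
    | (many) "k + 1 \<le> card ?X"
    by fastforce
  then show ?thesis
  proof cases
    case alone
    have "heard v c (Suc ?a)"
      using alone act_round[OF c, of 1 ?a] rdy m_pos by (intro heard_alone[OF e, of 1]) auto
    moreover have "timely v (Suc ?a)"
      unfolding timely_def using ab N
      by (intro exI[of _ a] exI[of _ b]) linarith
    ultimately show ?thesis by blast
  next
    case few
    have w: "ready w ?a" "?a < activation w + m"
      using few(3) act_round[of w 1 ?a] edge_in[OF few(1)] by (auto split: if_splits)
    obtain a' b' where ab': "2 ^ a' \<le> ?N w" "(k + 1) ^ b' \<le> ?N w"
      "activation w < ?N w + 2 * m * a' + (m + n) * b'"
      using IH[OF few(1)] unfolding timely_def by blast
    have sum: "?N c + ?N w < ?N v"
      using sum_card_subtree_less[of "{c, w}" v] few e v by simp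
    \<comment> \<open>The smaller of the two subtrees has at most half the size of that of
      \<open>v\<close>. If it belongs to \<open>w\<close>, then \<open>c\<close> is activated up to
      \<open>m\<close> rounds after \<open>w\<close> and delayed by \<open>m\<close> more, whence
      the cost \<open>2 * m\<close>.\<close>
    have "timely v (?a + m)"
    proof (cases "?N c \<le> ?N w")
      case True
      then show ?thesis unfolding timely_def using ab sum
        by (intro exI[of _ "Suc a"] exI[of _ b]) (simp add: algebra_simps)
    next
      case False
      then show ?thesis unfolding timely_def using ab' sum w
        by (intro exI[of _ "Suc a'"] exI[of _ b']) (simp add: algebra_simps)
    qed
    then show ?thesis using heard_selective[OF e rdy few(4)] by blast
  next
    case many
    have "c \<in> ?X" using e m_pos by simp
    then have "?X \<subseteq> {u. (u, v) \<in> E}" "?X \<noteq> {}" by blast+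
    then obtain x where x: "x \<in> ?X" "(k + 1) * ?N x \<le> ?N v"
      using exists_small_child_subtree[OF _ v _ many] by blast
    then have x': "(x, v) \<in> E" "?a < activation x + m" by auto
    obtain a' b' where ab': "2 ^ a' \<le> ?N x" "(k + 1) ^ b' \<le> ?N x"
      "activation x < ?N x + 2 * m * a' + (m + n) * b'"
      using IH[OF x'(1)] unfolding timely_def by blast
    have less: "?N x < ?N v" using card_child_subtree[OF x'(1)] .
    have "(k + 1) ^ Suc b' \<le> (k + 1) * ?N x"
      unfolding power_Suc using ab'(2) by (rule mult_le_mono2)
    also note x(2)
    finally have "(k + 1) ^ Suc b' \<le> ?N v" .
    \<comment> \<open>The additional factor \<open>k + 1\<close> pays \<open>m\<close> for the gap
      between the activations of \<open>x\<close> and \<open>c\<close> and \<open>n\<close> for the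
      round robin.\<close>
    then have "timely v (?a + n)" unfolding timely_def using ab' less x'
      by (intro exI[of _ a'] exI[of _ "Suc b'"]) (simp add: algebra_simps)
    then show ?thesis using heard_round_robin[OF e rdy] by blast
  qed
qed

text \<open>The child heard last determines readiness, so the maximum of the rounds from
  \<open>heard_timely\<close> works. The bound passes on to the activation, which is no
  later.\<close>

lemma ready_timely: "v \<in> V \<Longrightarrow> ready v (activation v) \<and> timely v (activation v)"
proof (induction v rule: wf_induct_rule[OF wf_E])
  case (1 v)
  let ?C = "{c. (c, v) \<in> E}"
  have "\<exists>s. ready v s \<and> timely v s"
  proof (cases "?C = {}")
    case True
    have "0 < card (subtree v)"
      using self_in_subtree[of v] finite_subtree[OF 1(2)] by (auto simp: card_gt_0_iff)
    then have "timely v 0" unfolding timely_def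
      by (intro exI[of _ 0]) auto
    then show ?thesis using True by (intro exI[of _ 0]) (auto simp: ready_def)
  next
    case False
    have "\<forall>c\<in>?C. \<exists>s. heard v c s \<and> timely v s"
      using heard_timely 1(1) edge_in by blast
    then obtain f where f: "\<And>c. c \<in> ?C \<Longrightarrow> heard v c (f c) \<and> timely v (f c)"
      by metis
    have "Max (f ` ?C) \<in> f ` ?C" using False finite_children by (intro Max_in) auto
    then have "timely v (Max (f ` ?C))" using f by auto
    moreover have "heard v c (Max (f ` ?C))" if "c \<in> ?C" for c
    proof -
      have "f c \<le> Max (f ` ?C)" using that finite_children by (intro Max_ge) auto
      then show ?thesis using heard_mono f[OF that] by blast
    qed
    ultimately show ?thesis unfolding ready_def by blast
  qed
  then obtain s where s: "ready v s" "timely v s" by blast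
  moreover have "timely v (activation v)"
    using s activation_le[OF s(1)] order_le_less_trans unfolding timely_def by blast
  ultimately show ?case using ready_activation by blast
qed

text \<open>Since \<open>n < (k + 1) ^ 3\<close>, at most two charges of the second kind occur, and
  with \<open>m \<le> n\<close> they cost at most \<open>4 * n\<close>. The size term adds
  \<open>n\<close> and the halvings \<open>2 * D * n\<close>.\<close>

lemma activation_bound:
  assumes v: "v \<in> V" and "n < (k + 1) ^ 3" and D: "\<And>a. 2 ^ a \<le> n \<Longrightarrow> m * a \<le> D * n" and "m \<le> n"
  shows "activation v \<le> (2 * D + 5) * n"
proof -
  have N: "card (subtree v) \<le> n"
    using card_mono[OF finite_V subtree_sub[OF v]] by (simp add: n_eq)
  obtain a b where ab: "2 ^ a \<le> card (subtree v)" "(k + 1) ^ b \<le> card (subtree v)"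
    "activation v < card (subtree v) + 2 * m * a + (m + n) * b"
    using ready_timely[OF v] unfolding timely_def by blast
  have "(k + 1) ^ b < (k + 1) ^ 3" using ab N assms(2) by linarith
  then have "b < 3" using k_pos by (subst (asm) power_strict_increasing_iff) auto
  then have "(m + n) * b \<le> (2 * n) * 2" using assms(4) by (intro mult_mono) auto
  moreover have "m * a \<le> D * n" using ab N by (intro D) simp
  ultimately show ?thesis using ab N by (simp add: algebra_simps)
qed

end


section \<open>The phases\<close>

lemma (in labelled_tree) position_eq_0_iff:
  "position v = 0 \<longleftrightarrow> (\<forall>u. (u, v) \<in> E \<longrightarrow> height u \<noteq> height v)"
  using position_initial[of v] position_step[of _ v] by (metis nat.distinct(1))

lemma transmitted_take:
  "t \<le> s \<Longrightarrow> transmitted n c pick v (take s H) t = transmitted n c pick v H t"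
  by (induction t) (auto simp: min_def)

locale bnd_dtree_run = preprocessing_run V E r lab n m k F
  for V :: "'v set" and E :: "('v \<times> 'v) set" and r :: 'v and lab :: "'v \<Rightarrow> nat" and n :: nat
    and m k :: nat and F :: "nat \<Rightarrow> nat set" +
  fixes c :: nat and pick :: pick
  assumes pick: "picks pick" and all_active: "v \<in> V \<Longrightarrow> activation v \<le> c * n"
begin

abbreviation prot :: protocol where
  "prot \<equiv> bnd_dtree n c m F pick"

definition run :: "nat \<Rightarrow> 'v \<Rightarrow> history" where
  "run t v = history_at E lab prot t v"

definition send :: "nat \<Rightarrow> 'v \<Rightarrow> message option" where
  "send t v = prot (lab v) (run t v)"

definition recv :: "nat \<Rightarrow> 'v \<Rightarrow> message option" where
  "recv t v = received E (send t) v"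

definition known :: "nat \<Rightarrow> 'v \<Rightarrow> nat set" where
  "known t v = rumors (lab v) (run t v)"

definition sent :: "nat \<Rightarrow> 'v \<Rightarrow> nat set" where
  "sent t v = transmitted n c pick (lab v) (run t v) t"

definition choice :: "nat \<Rightarrow> 'v \<Rightarrow> nat option" where
  "choice t v = all_choice n c pick (lab v) (sent t v) (run t v)"

definition start :: "nat \<Rightarrow> nat" where
  "start h = preprocessing_steps n c + 6 * n * h"

section \<open>Basic facts about a run of the full algorithm\<close>

lemma send_eq_action: "send t = action E lab prot t"
  by (rule ext) (simp only: send_def run_def)

lemma length_run [simp]: "length (run t v) = t"
  by (simp add: run_def)

lemma take_run: "s \<le> t \<Longrightarrow> take s (run t v) = run s v"
  by (simp add: run_def take_history_at)

lemma run_Suc: "run (Suc t) v = run t v @ [recv t v]"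
  unfolding run_def recv_def send_eq_action by simp

lemma set_run: "msg \<in> set (run t v) \<longleftrightarrow> (\<exists>s<t. recv s v = msg)"
  unfolding run_def recv_def send_eq_action by (rule set_history_at)

lemma set_drop_run:
  "s \<le> t \<Longrightarrow> msg \<in> set (drop s (run t v)) \<longleftrightarrow> (\<exists>i<t - s. recv (s + i) v = msg)"
  unfolding run_def recv_def send_eq_action by (rule set_drop_history_at)

lemma recv_SomeE:
  assumes "recv t v = Some msg"
  obtains u where "(u, v) \<in> E" "send t u = Some msg" "send t v = None"
  using received_SomeD[OF assms[unfolded recv_def]] by blast

lemma recv_SomeI:
  assumes "(u, v) \<in> E" "send t u = Some msg" "send t v = None"
    and "\<And>u'. (u', v) \<in> E \<Longrightarrow> u' \<noteq> u \<Longrightarrow> send t u' = None"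
  shows "recv t v = Some msg"
  unfolding recv_def using assms by (rule received_SomeI)

lemma known_iff: "x \<in> known t v \<longleftrightarrow> x = lab v \<or> (\<exists>s<t. recv s v = Some (Rumor x))"
  by (auto simp: known_def rumors_def set_run)

lemma known_mono: "s \<le> t \<Longrightarrow> known s v \<subseteq> known t v"
  using order_less_le_trans by (fastforce simp: known_iff)

lemma known_Suc: "x \<in> known (Suc t) v \<longleftrightarrow> x \<in> known t v \<or> recv t v = Some (Rumor x)"
  by (auto simp: known_iff less_Suc_eq)

lemma run_preprocessing:
  assumes "t \<le> preprocessing_steps n c"
  shows "run t v = hist t v"
proof -
  have "history_at E lab prot t = history_at E lab (preprocessing n m F) t"
    using assms by (intro history_at_cong) (auto simp: bnd_dtree_def)
  then show ?thesis by (simp add: run_def)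
qed

lemma send_preprocessing: "t < preprocessing_steps n c \<Longrightarrow> send t = act t"
  by (rule ext) (simp add: send_def bnd_dtree_def run_preprocessing)

lemma n_le_preprocessing: "n \<le> preprocessing_steps n c"
  by (simp add: preprocessing_steps_def)

section \<open>Rumors known and sent\<close>

lemma sent_Suc: "sent (Suc t) v = sent t v \<union> set_option (choice t v)"
proof -
  have "transmitted n c pick (lab v) (run (Suc t) v) t = sent t v"
    using transmitted_take[of t t n c pick "lab v" "run (Suc t) v"] by (simp add: sent_def take_run)
  then show ?thesis by (simp add: sent_def[of "Suc t"] choice_def take_run)
qed

lemma choiceD:
  assumes "choice t v = Some x"
  shows "allotted n c (run t v)" "x \<in> known t v" "x \<notin> sent t v"
proof -
  have *: "allotted n c (run t v)" "known t v - sent t v \<noteq> {}"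
    "x = pick (lab v) (run t v) (known t v - sent t v)"
    using assms by (auto simp: choice_def all_choice_def known_def split: if_splits)
  have "x \<in> known t v - sent t v"
    unfolding *(3) using pick[unfolded picks_def, rule_format, OF *(2)] .
  with *(1) show "allotted n c (run t v)" "x \<in> known t v" "x \<notin> sent t v" by simp_all
qed

lemma choice_NoneD: "choice t v = None \<Longrightarrow> allotted n c (run t v) \<Longrightarrow> known t v \<subseteq> sent t v"
  by (auto simp: choice_def all_choice_def known_def split: if_splits)

lemma sent_subset_known: "sent t v \<subseteq> known t v"
proof (induction t)
  case 0
  then show ?case by (simp add: sent_def)
next
  case (Suc t)
  have "set_option (choice t v) \<subseteq> known t v" using choiceD by (cases "choice t v") auto
  then show ?case using Suc known_mono[of t "Suc t" v] by (auto simp: sent_Suc)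
qed

lemma stage_all_message_eq:
  "stage_all_message n c pick (lab v) (run t v) = map_option Rumor (choice t v)"
  by (simp add: stage_all_message_def choice_def sent_def)

text \<open>After the preprocessing neither labels nor 2-heights are announced, so what a node has
  learnt about its children stays valid.\<close>

lemma send_later:
  assumes "preprocessing_steps n c \<le> t" "send t v = Some msg"
  shows "(\<exists>b. msg = Parity b) \<or> (\<exists>x\<in>known t v. msg = Rumor x)"
proof -
  have "\<exists>b. msg = Parity b" if "parity_message n c (run t v) = Some msg"
    using that by (auto simp: parity_message_def split: if_splits option.splits message.splits)
  moreover have "\<exists>x\<in>known t v. msg = Rumor x" if "stage_all_message n c pick (lab v) (run t v) = Some msg"
    using that choiceD(2) unfolding stage_all_message_eq by auto
  moreover have "\<exists>x\<in>known t v. msg = Rumor x" if "stage_rr_message n c (lab v) (run t v) = Some msg"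
    using that by (auto simp: stage_rr_message_def Let_def known_def split: if_splits)
  ultimately show ?thesis
    using assms by (auto simp: send_def bnd_dtree_def split: if_splits)
qed

lemma send_rumor:
  assumes "send t v = Some (Rumor x)"
  shows "x \<in> known t v"
proof (cases "t < preprocessing_steps n c")
  case True
  then have "act t v = Some (Rumor x)" using assms send_preprocessing by simp
  then show ?thesis
    using act_label[of t v] act_later[of t v] by (cases "t < n") (auto split: if_splits)
next
  case False
  then show ?thesis using send_later[of t v] assms by auto
qed

text \<open>Rumors travel only towards the root. This bounds the number of rumors a node can send
  and rules out collisions in Stage RR.\<close>

lemma known_subtree: "v \<in> V \<Longrightarrow> known t v \<subseteq> lab ` subtree v"
proof (induction t arbitrary: v)
  case 0
  then show ?case using self_in_subtree by (auto simp: known_iff)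
next
  case (Suc t)
  show ?case
  proof
    fix x assume "x \<in> known (Suc t) v"
    then consider "x \<in> known t v" | "recv t v = Some (Rumor x)" using known_Suc by blast
    then show "x \<in> lab ` subtree v"
    proof cases
      case 1
      then show ?thesis using Suc by blast
    next
      case 2
      then obtain u where u: "(u, v) \<in> E" "send t u = Some (Rumor x)"
        by (rule recv_SomeE)
      then have "x \<in> lab ` subtree u" using Suc.IH[of u] edge_in send_rumor by blast
      then show ?thesis using u subtree_unfold[of v] by blast
    qed
  qed
qed

lemma known_less: "v \<in> V \<Longrightarrow> x \<in> known t v \<Longrightarrow> x < n"
  using known_subtree[of v t] subtree_sub[of v] lab_less by blast

lemma sent_subset: "v \<in> V \<Longrightarrow> sent t v \<subseteq> {..<n}"
  using sent_subset_known known_less by fastforce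

lemma card_sent_le: "v \<in> V \<Longrightarrow> card (sent t v) \<le> n"
  using card_mono[OF _ sent_subset[of v t]] by simp

lemma finite_sent: "v \<in> V \<Longrightarrow> finite (sent t v)"
  using sent_subset finite_subset by blast

lemma recv_height:
  assumes "recv t v = Some (Height x j)"
  shows "\<exists>u. (u, v) \<in> E \<and> x = lab u \<and> j = height u"
proof (cases "t < preprocessing_steps n c")
  case True
  then show ?thesis using assms received_height by (simp add: recv_def send_preprocessing)
next
  case False
  obtain u where "send t u = Some (Height x j)" using assms by (rule recv_SomeE)
  then show ?thesis using send_later[of t u "Height x j"] False by simp
qed

text \<open>All nodes are ready by round \<open>c * n\<close>, at whose start the preprocessing has
  ended, and later messages carry no 2-heights.\<close>

lemma heights_known:
  assumes "v \<in> V" "preprocessing_steps n c \<le> t"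
  shows "children n (run t v) = lab ` {u. (u, v) \<in> E}"
    and "(u, v) \<in> E \<Longrightarrow> child_height (run t v) (lab u) = height u"
    and "own_height n (run t v) = height v"
proof -
  have "children n (run t v) = children n (hist n v)"
    using assms n_le_preprocessing
    by (simp add: children_def take_run run_preprocessing take_history_at)
  then show ch: "children n (run t v) = lab ` {u. (u, v) \<in> E}"
    by (simp add: children_correct)
  have corr: "\<exists>u. (u, v) \<in> E \<and> x = lab u \<and> j = height u"
    if "Some (Height x j) \<in> set (run t v)" for x j
    using that recv_height unfolding set_run by blast
  have all: "\<exists>j. Some (Height (lab u) j) \<in> set (run t v)" if u: "(u, v) \<in> E" for u
  proof -
    have "ready v (c * n)"
      using ready_timely[OF assms(1)] all_active[OF assms(1)] ready_mono by blast
    then have "heard v u (c * n)" using u by (simp add: ready_def)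
    then obtain s where s: "s < preprocessing_steps n c"
      "received E (act s) v = Some (Height (lab u) (height u))"
      unfolding heard_def preprocessing_steps_def by blast
    then have "recv s v = Some (Height (lab u) (height u))"
      by (simp add: recv_def send_preprocessing)
    then show ?thesis using s assms(2) unfolding set_run by (meson order_less_le_trans)
  qed
  show "(u, v) \<in> E \<Longrightarrow> child_height (run t v) (lab u) = height u"
    by (rule own_height_correct(1)[OF assms(1) ch corr all])
  show "own_height n (run t v) = height v"
    by (rule own_height_correct(2)[OF assms(1) ch corr all])
qed

lemma initial_iff:
  assumes "v \<in> V" "preprocessing_steps n c \<le> t"
  shows "initial n (run t v) \<longleftrightarrow> position v = 0"
  using heights_known[OF assms] by (auto simp: initial_def position_eq_0_iff)

section \<open>Actions within a phase and the parity stage\<close>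

lemma phase_start:
  assumes "j < 6 * n"
  shows "phase n c (run (start h + j) v) = h" "phase_step n c (run (start h + j) v) = j"
  using assms by (auto simp: phase_def phase_step_def start_def)

lemma start_ge: "preprocessing_steps n c \<le> start h + j"
  by (simp add: start_def)

lemma may_transmit_iff:
  assumes "v \<in> V" "j < 6 * n"
  shows "may_transmit n c (run (start h + j) v) \<longleftrightarrow> height v = h"
  using heights_known(3)[OF assms(1) start_ge[of h j]] height_le_last_phase[OF assms(1)]
    phase_start[OF assms(2), of h v] start_ge[of h j]
  by (auto simp: may_transmit_def)

lemma send_phase:
  assumes "v \<in> V" "j < 6 * n"
  shows "send (start h + j) v =
    (if height v \<noteq> h then None
     else if j < n then parity_message n c (run (start h + j) v)
     else if j < 5 * n then map_option Rumor (choice (start h + j) v)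
     else if j - 5 * n \<in> known (start h + j) v then Some (Rumor (j - 5 * n)) else None)"
proof -
  have "\<not> start h + j < preprocessing_steps n c" using start_ge[of h j] by simp
  moreover have "n \<le> j \<Longrightarrow> in_stage_all n c (run (start h + j) v) \<longleftrightarrow> j < 5 * n"
    using phase_start[OF assms(2)] by (simp add: in_stage_all_def)
  ultimately show ?thesis
    using may_transmit_iff[OF assms, of h] phase_start[OF assms(2), of h v]
    by (simp add: send_def bnd_dtree_def stage_all_message_eq stage_rr_message_def Let_def known_def)
qed

lemma send_phase_other:
  "v \<in> V \<Longrightarrow> j < 6 * n \<Longrightarrow> height v \<noteq> h \<Longrightarrow> send (start h + j) v = None"
  by (simp add: send_phase)

text \<open>In phase \<open>height v\<close> no child except \<open>u\<close> may transmit, so there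
  are no collisions.\<close>

lemma recv_same_height:
  assumes "(u, v) \<in> E" "height u = height v" "j < 6 * n"
    and "send (start (height v) + j) v = None"
  shows "recv (start (height v) + j) v = send (start (height v) + j) u"
proof -
  let ?t = "start (height v) + j"
  have other: "send ?t u' = None" if "(u', v) \<in> E" "u' \<noteq> u" for u'
    using that assms same_height_child_unique[of u v u'] edge_in by (intro send_phase_other) auto
  show ?thesis
  proof (cases "send ?t u")
    case None
    then have "recv ?t v \<noteq> Some msg" for msg
      using other by (metis option.distinct(1) recv_SomeE)
    then show ?thesis using None by (metis option.exhaust)
  next
    case (Some msg)
    then show ?thesis using recv_SomeI[OF assms(1) Some assms(4) other] by simp
  qed
qed

lemma recv_phase_child:
  assumes "recv (start h + j) v = Some msg" "j < 6 * n"
  obtains u where "(u, v) \<in> E" "height u = h" "send (start h + j) u = Some msg"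
proof -
  obtain u where u: "(u, v) \<in> E" "send (start h + j) u = Some msg"
    using assms(1) by (rule recv_SomeE)
  then have "height u = h" using send_phase_other[of u j h] assms(2) edge_in by fastforce
  then show thesis using that u by blast
qed

text \<open>The parity message advances by one node per step, so the position of a node is also the
  time at which it sends.\<close>

lemma send_parity:
  "v \<in> V \<Longrightarrow> j < n \<Longrightarrow> send (start (height v) + j) v =
    (if position v = j then Some (Parity (even j)) else None)"
proof (induction j arbitrary: v)
  case 0
  have "position v = 0 \<longleftrightarrow> initial n (run (start (height v) + 0) v)"
    using initial_iff[OF 0(1) start_ge] by blast
  moreover have "phase_step n c (run (start (height v) + 0) v) = 0"
    using 0 by (intro phase_start) simp
  ultimately show ?case
    using 0 by (subst send_phase) (simp_all add: parity_message_def)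
next
  case (Suc j)
  let ?t = "start (height v) + j"
  have j: "j < n" using Suc by simp
  have "phase_step n c (run (start (height v) + Suc j) v) = Suc j"
    using Suc by (intro phase_start) simp
  moreover have "last (run (start (height v) + Suc j) v) = recv ?t v"
    by (simp add: run_Suc)
  ultimately have send: "send (start (height v) + Suc j) v =
      (case recv ?t v of Some (Parity b) \<Rightarrow> Some (Parity (\<not> b)) | _ \<Rightarrow> None)"
    using Suc by (subst send_phase) (simp_all add: parity_message_def)
  show ?case
  proof (cases "\<exists>u. (u, v) \<in> E \<and> height u = height v")
    case True
    then obtain u where u: "(u, v) \<in> E" "height u = height v" by blast
    have pos: "position v = Suc (position u)" using position_step[OF u] .
    have su: "send ?t u = (if position u = j then Some (Parity (even j)) else None)"
      using Suc.IH[of u] j u edge_in by simp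
    have sv: "send ?t v = (if position v = j then Some (Parity (even j)) else None)"
      using Suc.IH[of v] j Suc.prems by simp
    show ?thesis
    proof (cases "position u = j")
      case True
      then have "recv ?t v = Some (Parity (even j))"
        using recv_same_height[OF u, of j] sv su pos j by simp
      then show ?thesis using send True pos by simp
    next
      case False
      \<comment> \<open>Either \<open>v\<close> transmits itself, or it receives while
        \<open>u\<close>, the only child that may transmit, is silent.\<close>
      have "recv ?t v = None"
      proof (cases "send ?t v")
        case None
        then show ?thesis using recv_same_height[OF u, of j] su False j by simp
      next
        case (Some a)
        then show ?thesis by (metis option.distinct(1) option.exhaust recv_SomeE)
      qed
      then show ?thesis using send False pos by simp
    qed
  next
    case False
    then have "position v = 0" using position_initial by blast
    moreover have "recv ?t v \<noteq> Some msg" for msg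
      using False recv_phase_child[of "height v" j v msg] j by auto
    then have "recv ?t v = None" by (metis option.exhaust)
    ultimately show ?thesis using send by simp
  qed
qed

text \<open>The predecessor \<open>u\<close> sends its parity in step \<open>position u < n\<close>,
  when \<open>v\<close> is silent because its position differs; after the parity stage the phase has
  only rumors.\<close>

lemma parity_received:
  assumes "v \<in> V" "n \<le> j" "j < 6 * n"
  shows "Parity b \<in> received_in_phase n c (run (start (height v) + j) v) \<longleftrightarrow>
    (\<exists>u. (u, v) \<in> E \<and> height u = height v \<and> b = even (position u))"
proof -
  let ?s = "start (height v)"
  have "Parity b \<in> received_in_phase n c (run (?s + j) v) \<longleftrightarrow>
      (\<exists>i<j. recv (?s + i) v = Some (Parity b))"
    using phase_start[OF assms(3), of "height v" v] set_drop_run[of ?s "?s + j" "Some (Parity b)" v]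
    by (simp add: received_in_phase_def)
  also have "\<dots> \<longleftrightarrow> (\<exists>u. (u, v) \<in> E \<and> height u = height v \<and> b = even (position u))"
  proof
    assume "\<exists>i<j. recv (?s + i) v = Some (Parity b)"
    then obtain i where i: "i < j" "recv (?s + i) v = Some (Parity b)" by blast
    then obtain u where u: "(u, v) \<in> E" "height u = height v" "send (?s + i) u = Some (Parity b)"
      using assms by (elim recv_phase_child) auto
    have uV: "u \<in> V" using u edge_in by simp
    have "i < n"
    proof (rule ccontr)
      assume "\<not> i < n"
      then show False
        using u(3) send_phase[OF uV, of i "height v"] i assms by (auto split: if_splits)
    qed
    then show "\<exists>u. (u, v) \<in> E \<and> height u = height v \<and> b = even (position u)"
      using u send_parity[OF uV, of i] by (intro exI[of _ u]) (auto split: if_splits)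
  next
    assume "\<exists>u. (u, v) \<in> E \<and> height u = height v \<and> b = even (position u)"
    then obtain u where u: "(u, v) \<in> E" "height u = height v" "b = even (position u)" by blast
    have uV: "u \<in> V" using u edge_in by simp
    let ?i = "position u"
    have i: "?i < n" using position_less[OF uV] .
    have "recv (?s + ?i) v = Some (Parity b)"
      using recv_same_height[OF u(1,2), of ?i] send_parity[OF uV i] send_parity[OF assms(1) i]
        position_step[OF u(1,2)] u i by simp
    then show "\<exists>i<j. recv (?s + i) v = Some (Parity b)" using i assms by (intro exI[of _ ?i]) auto
  qed
  finally show ?thesis .
qed

section \<open>Stage All\<close>

lemma allotted_iff:
  assumes "v \<in> V" "j < 4 * n"
  shows "allotted n c (run (start (height v) + (n + j)) v) \<longleftrightarrow> (even j \<longleftrightarrow> even (position v))"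
proof -
  let ?H = "run (start (height v) + (n + j)) v"
  have j: "n + j < 6 * n" using assms by simp
  \<comment> \<open>The parity heard is that of the predecessor, hence opposite to that of
    \<open>v\<close>; the initial node hears none.\<close>
  have parity: "Parity b \<in> received_in_phase n c ?H \<longleftrightarrow> position v \<noteq> 0 \<and> (b \<longleftrightarrow> odd (position v))" for b
  proof (cases "position v = 0")
    case True
    then show ?thesis using parity_received[OF assms(1) _ j] position_eq_0_iff[of v] by auto
  next
    case False
    then obtain u where u: "(u, v) \<in> E" "height u = height v" using position_initial[of v] by metis
    then have "(\<exists>w. (w, v) \<in> E \<and> height w = height v \<and> b = even (position w)) \<longleftrightarrow>
        b = even (position u)"
      using same_height_child_unique by blast
    then show ?thesis
      using parity_received[OF assms(1) _ j, of b] position_step[OF u] by auto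
  qed
  have "initial n ?H \<longleftrightarrow> position v = 0" by (rule initial_iff[OF assms(1) start_ge])
  then have "even_position n c ?H \<longleftrightarrow> even (position v)" "odd_position n c ?H \<longleftrightarrow> odd (position v)"
    unfolding even_position_def odd_position_def parity by (cases "position v = 0"; simp)+
  moreover have "may_transmit n c ?H" using may_transmit_iff[OF assms(1) j] by simp
  ultimately show ?thesis
    using phase_start[OF j, of "height v" v] assms by (simp add: allotted_def in_stage_all_def)
qed

lemma not_allotted_before:
  assumes "v \<in> V" "t < start (height v) + n"
  shows "\<not> allotted n c (run t v)"
proof
  let ?S = "preprocessing_steps n c"
  assume "allotted n c (run t v)"
  then have a: "?S \<le> t" "own_height n (run t v) = (t - ?S) div (6 * n)" "n \<le> (t - ?S) mod (6 * n)"
    by (auto simp: allotted_def may_transmit_def in_stage_all_def phase_def phase_step_def)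
  then have "height v = (t - ?S) div (6 * n)" using heights_known(3)[OF assms(1)] by simp
  then have "6 * n * height v + (t - ?S) mod (6 * n) = t - ?S" by simp
  then show False using a(1,3) assms(2) unfolding start_def by linarith
qed

lemma sent_before: "v \<in> V \<Longrightarrow> t \<le> start (height v) + n \<Longrightarrow> sent t v = {}"
proof (induction t)
  case 0
  then show ?case by (simp add: sent_def)
next
  case (Suc t)
  have "choice t v = None"
    using not_allotted_before[of v t] Suc.prems choiceD(1) by (metis Suc_le_lessD option.exhaust)
  then show ?case using Suc by (simp add: sent_Suc)
qed

text \<open>Consecutive nodes of a path have opposite parities, so \<open>v\<close> is receiving
  whenever \<open>u\<close> sends, and no rumor is lost.\<close>

lemma sent_received:
  assumes e: "(u, v) \<in> E" "height u = height v"
  shows "j \<le> 4 * n \<Longrightarrow> sent (start (height v) + (n + j)) u \<subseteq> known (start (height v) + (n + j)) v"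
proof (induction j)
  case 0
  then show ?case using sent_before[of u] e edge_in by simp
next
  case (Suc j)
  let ?t = "start (height v) + (n + j)"
  have u: "u \<in> V" and v: "v \<in> V" using e edge_in by auto
  have j: "j < 4 * n" using Suc by simp
  have "set_option (choice ?t u) \<subseteq> known (Suc ?t) v"
  proof (cases "choice ?t u")
    case (Some x)
    have "\<not> allotted n c (run ?t v)"
      using choiceD(1)[OF Some] allotted_iff[OF u j] allotted_iff[OF v j] position_step[OF e] e(2)
      by simp
    then have "choice ?t v = None" using choiceD(1) by (metis option.exhaust)
    then have "send ?t v = None" using j v by (subst send_phase) auto
    then have "recv ?t v = send ?t u" using recv_same_height[OF e] j by simp
    also have "\<dots> = Some (Rumor x)" using j u e Some by (subst send_phase) auto
    finally show ?thesis using Some by (simp add: known_Suc)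
  qed simp
  then show ?case
    using Suc.IH j known_mono[of ?t "Suc ?t" v] by (auto simp: sent_Suc)
qed

text \<open>The invariant between phases. The rumors are required at the parent of \<open>u\<close>,
  since phase \<open>h\<close> starts from what the lower subtrees have already handed over.\<close>

definition collected :: "nat \<Rightarrow> bool" where
  "collected h \<longleftrightarrow>
    (\<forall>u v. (u, v) \<in> E \<longrightarrow> height u < h \<longrightarrow> lab ` subtree u \<subseteq> known (start h) v)"

text \<open>
  The inequality is the pipelining invariant of Stage All: a node at position \<open>p\<close> sends in every
  second step from step \<open>p\<close> on until it has sent everything. An idle node has sent all that its
  predecessor has sent, and the parity of \<open>j - p\<close> makes up for the steps not allotted to it.
\<close>

lemma sent_progress:
  assumes "collected h"
  shows "v \<in> V \<Longrightarrow> height v = h \<Longrightarrow> j \<le> 4 * n \<Longrightarrow>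
    lab ` subtree v \<subseteq> sent (start h + (n + j)) v \<or>
    j \<le> 2 * card (sent (start h + (n + j)) v) + position v"
proof (induction j arbitrary: v)
  case 0
  then show ?case by simp
next
  case (Suc j)
  let ?t = "start h + (n + j)"
  have j: "j < 4 * n" using Suc by simp
  have v: "v \<in> V" "height v = h" using Suc by auto
  have IH: "lab ` subtree v \<subseteq> sent ?t v \<or> j \<le> 2 * card (sent ?t v) + position v"
    using Suc by simp
  have mono: "sent ?t v \<subseteq> sent (Suc ?t) v" by (auto simp: sent_Suc)
  have al: "allotted n c (run ?t v) \<longleftrightarrow> (even j \<longleftrightarrow> even (position v))"
    using allotted_iff[OF v(1) j] v by simp
  have goal: "lab ` subtree v \<subseteq> sent (Suc ?t) v \<or> Suc j \<le> 2 * card (sent (Suc ?t) v) + position v"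
  proof (cases "choice ?t v")
    case (Some x)
    then have "card (sent (Suc ?t) v) = Suc (card (sent ?t v))"
      using choiceD(3)[OF Some] finite_sent[OF v(1)] by (simp add: sent_Suc)
    then show ?thesis using IH mono by auto
  next
    case None
    then have same: "sent (Suc ?t) v = sent ?t v" by (simp add: sent_Suc)
    show ?thesis
    proof (cases "allotted n c (run ?t v)")
      case False
      \<comment> \<open>In a step not allotted to \<open>v\<close> the two sides of the invariant
        differ in parity, so the inequality is strict and leaves room for one more step.\<close>
      have "even (2 * card (sent ?t v) + position v) \<longleftrightarrow> even (position v)" by simp
      then have "j \<noteq> 2 * card (sent ?t v) + position v" using al False by metis
      then show ?thesis using IH unfolding same by (metis Suc_leI le_neq_implies_less)
    next
      case True
      then have known: "known ?t v \<subseteq> sent ?t v" using choice_NoneD None by blast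
      have own: "lab v \<in> known ?t v" by (simp add: known_iff)
      have low: "lab ` subtree u \<subseteq> known ?t v" if "(u, v) \<in> E" "height u < h" for u
        using that assms known_mono[of "start h" ?t v] unfolding collected_def by auto
      show ?thesis
      proof (cases "\<exists>u. (u, v) \<in> E \<and> height u = height v")
        \<comment> \<open>Without a predecessor on the path, all children have smaller 2-height and
          have delivered in earlier phases.\<close>
        case False
        then have "height u < h" if "(u, v) \<in> E" for u
          using that height_child_le[OF that] v by (metis le_neq_implies_less)
        then have "lab ` subtree v \<subseteq> known ?t v"
          using low own by (subst subtree_unfold) blast
        then show ?thesis using known unfolding same by blast
      next
        case True
        then obtain u where u: "(u, v) \<in> E" "height u = height v" by blast
        have uV: "u \<in> V" using u edge_in by simp
        have su: "sent ?t u \<subseteq> sent ?t v"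
          using sent_received[OF u, of j] j v known by simp
        have "lab ` subtree u \<subseteq> sent ?t u \<or> j \<le> 2 * card (sent ?t u) + position u"
          using Suc.IH[OF uV] u v j by simp
        then show ?thesis
        proof
          assume *: "lab ` subtree u \<subseteq> sent ?t u"
          have "lab ` subtree w \<subseteq> sent ?t v" if w: "(w, v) \<in> E" for w
          proof (cases "w = u")
            case True
            then show ?thesis using * su by blast
          next
            case False
            then have "height w < h"
              using same_height_child_unique[OF u(1) w u(2)] height_child_le[OF w] v
              by (metis le_neq_implies_less)
            then show ?thesis using low[OF w] known by blast
          qed
          then have "lab ` subtree v \<subseteq> sent ?t v"
            using own known by (subst subtree_unfold) blast
          then show ?thesis using same by simp
        next
          \<comment> \<open>The position of \<open>v\<close> exceeds that of \<open>u\<close> by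
            one, which supplies the additional step.\<close>
          assume "j \<le> 2 * card (sent ?t u) + position u"
          moreover have "card (sent ?t u) \<le> card (sent ?t v)"
            using su finite_sent[OF v(1)] card_mono by blast
          ultimately show ?thesis using same position_step[OF u] by simp
        qed
      qed
    qed
  qed
  then show ?case by simp
qed

text \<open>A node can send at most \<open>n\<close> rumors and positions are below
  \<open>n\<close>, so after \<open>4 * n\<close> steps the counting alternative of
  \<open>sent_progress\<close> fails.\<close>

lemma sent_all:
  assumes "collected h" "v \<in> V" "height v = h"
  shows "lab ` subtree v \<subseteq> sent (start h + 5 * n) v"
proof -
  have "4 * n > 2 * card (sent (start h + 5 * n) v) + position v"
    using card_sent_le[OF assms(2), of "start h + 5 * n"] position_less[OF assms(2)] by linarith
  then show ?thesis using sent_progress[OF assms, of "4 * n"] by simp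
qed

lemma collected_Suc:
  assumes "collected h"
  shows "collected (Suc h)"
  unfolding collected_def
proof (intro allI impI)
  fix u v assume e: "(u, v) \<in> E" and "height u < Suc h"
  have u: "u \<in> V" and v: "v \<in> V" using e edge_in by auto
  have later: "start h \<le> start (Suc h)" "start h + 5 * n \<le> start (Suc h)" by (auto simp: start_def)
  \<comment> \<open>The rumors arrive before phase \<open>h\<close>, or at the next node of the path
    in Stage All, or from the top of the path in Stage RR.\<close>
  consider "height u < h" | "height u = h" "height v = h" | "height u = h" "height v \<noteq> h"
    using \<open>height u < Suc h\<close> by linarith
  then show "lab ` subtree u \<subseteq> known (start (Suc h)) v"
  proof cases
    case 1
    then show ?thesis using assms e known_mono[OF later(1)] unfolding collected_def by blast
  next
    case 2
    have "sent (start h + 5 * n) u \<subseteq> known (start h + 5 * n) v"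
      using sent_received[OF e, of "4 * n"] 2 by simp
    then show ?thesis
      using sent_all[OF assms u 2(1)] known_mono[OF later(2), of v] by blast
  next
    case 3
    show ?thesis
    proof
      fix x assume x: "x \<in> lab ` subtree u"
      have "lab ` subtree u \<subseteq> known (start h + 5 * n) u"
        using sent_all[OF assms u 3(1)] sent_subset_known by blast
      then have xk: "x \<in> known (start h + 5 * n) u" using x by blast
      have xn: "x < n" using known_less[OF u xk] .
      let ?t = "start h + (5 * n + x)"
      have j: "5 * n + x < 6 * n" using xn by simp
      have send: "send ?t w = (if height w = h \<and> x \<in> known ?t w then Some (Rumor x) else None)"
        if "w \<in> V" for w
        using send_phase[OF that j, of h] n_pos by simp
      have "recv ?t v = Some (Rumor x)"
      proof (rule recv_SomeI[OF e])
        show "send ?t u = Some (Rumor x)"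
          using send[OF u] 3 xk known_mono[of "start h + 5 * n" ?t u] by auto
        show "send ?t v = None" using send[OF v] 3 by simp
        show "send ?t w = None" if w: "(w, v) \<in> E" "w \<noteq> u" for w
        proof -
          have wV: "w \<in> V" using w edge_in by simp
          \<comment> \<open>No sibling can hold \<open>x\<close>, so all of them are silent in the
            step reserved for it.\<close>
          have "lab ` subtree w \<inter> lab ` subtree u = {}"
            using subtree_disjoint[OF w(1) e w(2)] subtree_sub[OF wV] subtree_sub[OF u]
            by (simp add: inj_on_image_Int[OF inj_lab, symmetric])
          then have "x \<notin> known ?t w" using x known_subtree[OF wV] by blast
          then show ?thesis using send[OF wV] by simp
        qed
      qed
      moreover have "?t < start (Suc h)" using xn by (simp add: start_def)
      ultimately show "x \<in> known (start (Suc h)) v" unfolding known_iff by blast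
    qed
  qed
qed

lemma collected: "collected h"
proof (induction h)
  case 0
  then show ?case by (simp add: collected_def)
qed (rule collected_Suc)

section \<open>Completion and message size\<close>

lemma gathered_end: "gathered V E r lab prot (start (Suc (last_phase n)))"
proof -
  let ?t = "start (Suc (last_phase n))"
  have "lab ` subtree u \<subseteq> known ?t r" if "(u, r) \<in> E" for u
    using that collected[of "Suc (last_phase n)"] height_le_last_phase[of u] edge_in
    unfolding collected_def by (simp add: le_imp_less_Suc)
  moreover have "lab r \<in> known ?t r" by (simp add: known_iff)
  ultimately have "lab ` V \<subseteq> known ?t r"
    using subtree_unfold[of r] by (auto simp: subtree_root)
  then show ?thesis by (auto simp: gathered_def known_def run_def)
qed

lemma bounded: "bounded_messages V E lab prot"
  unfolding bounded_messages_def
proof (intro allI ballI impI)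
  fix t v msg assume v: "v \<in> V" and "action E lab prot t v = Some msg"
  then have s: "send t v = Some msg" by (simp add: send_def run_def)
  have "bounded_message n msg"
  proof (cases "t < preprocessing_steps n c")
    case False
    then show ?thesis using send_later[OF _ s] known_less[OF v] by auto
  next
    case True
    then have a: "act t v = Some msg" using s send_preprocessing by simp
    show ?thesis
    proof (cases "t < n")
      case True
      then show ?thesis using a act_label[OF True, of v] by (auto split: if_splits)
    next
      case False
      then obtain j where "msg = Height (lab v) j" using act_later[OF _ a] by auto
      then show ?thesis using act_height[OF v, of t "lab v" j] a lab_less[OF v] height_less[OF v] by simp
    qed
  qed
  then show "bounded_message (card V) msg" by (simp add: n_eq)
qed

end


section \<open>Running time\<close>

lemma kappa_ge_root: "root 3 (real n) \<le> real (kappa n)"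
  by (simp add: kappa_def)

text \<open>Strictness matters: a power of \<open>kappa n + 1\<close> not exceeding \<open>n\<close>
  then has exponent at most 2.\<close>

lemma less_kappa_Suc_cubed: "n < (kappa n + 1) ^ 3"
proof -
  have "real n = root 3 (real n) ^ 3" by simp
  also have "\<dots> \<le> real (kappa n) ^ 3" using kappa_ge_root by (intro power_mono) auto
  also have "\<dots> < (real (kappa n) + 1) ^ 3" by (intro power_strict_mono) auto
  finally have "real n < real ((kappa n + 1) ^ 3)" by (simp add: add.commute)
  then show ?thesis by (simp only: of_nat_less_iff)
qed

lemma kappa_pos: "0 < n \<Longrightarrow> 0 < kappa n"
  using kappa_ge_root[of n] by (metis of_nat_0_less_iff order_less_le_trans real_root_gt_zero zero_less_numeral)

lemma kappa_bigo: "(\<lambda>n. (real (kappa n))\<^sup>2 * log 2 (real n)) \<in> O(\<lambda>n. real n powr (2/3) * log 2 (real n))"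
proof (intro landau_o.big.mult bigoI[of _ 4])
  show "\<forall>\<^sub>F n in sequentially. norm ((real (kappa n))\<^sup>2) \<le> 4 * norm (real n powr (2/3))"
    using eventually_ge_at_top[of 1]
  proof eventually_elim
    case (elim n)
    have "1 \<le> root 3 (real n)" using elim by simp
    \<comment> \<open>The root is at least 1, so rounding it up at most doubles it.\<close>
    then have "real (kappa n) \<le> 2 * root 3 (real n)" unfolding kappa_def by linarith
    then have "(real (kappa n))\<^sup>2 \<le> (2 * root 3 (real n))\<^sup>2" by (intro power_mono) auto
    also have "\<dots> = 4 * (real n powr (1/3)) powr 2"
      using elim by (simp add: power_mult_distrib root_powr_inverse)
    also have "\<dots> = 4 * real n powr (2/3)" by (simp add: powr_powr)
    finally show ?case by simp
  qed
qed simp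

text \<open>The product of \<open>m n\<close> and the logarithm is of order at most
  \<open>n^(2/3) log^2 n\<close>, hence linear. The exponent \<open>a\<close> stands for the
  logarithm, and \<open>D\<close> also covers the finitely many small \<open>n\<close>.\<close>

lemma selector_size_times_log:
  fixes m :: "nat \<Rightarrow> nat"
  assumes m_le: "\<And>n. m n \<le> n"
    and m_bigo: "(\<lambda>n. real (m n)) \<in> O(\<lambda>n. (real (kappa n))\<^sup>2 * log 2 (real n))"
  shows "\<exists>D. \<forall>n a. 2 ^ a \<le> n \<longrightarrow> m n * a \<le> D * n"
proof -
  have "(\<lambda>n. real (m n)) \<in> O(\<lambda>n. real n powr (2/3) * log 2 (real n))"
    using m_bigo kappa_bigo by (rule landau_o.big_trans)
  then have "(\<lambda>n. real (m n) * log 2 (real n)) \<in> O(\<lambda>n. real n powr (2/3) * log 2 (real n) * log 2 (real n))"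
    by (intro landau_o.big.mult) auto
  also have "(\<lambda>n. real n powr (2/3) * log 2 (real n) * log 2 (real n)) \<in> O(\<lambda>n. real n)"
    by real_asymp
  finally obtain B where "\<forall>\<^sub>F n in sequentially. norm (real (m n) * log 2 (real n)) \<le> B * norm (real n)"
    by (elim landau_o.bigE)
  then obtain N where N: "\<And>n. N \<le> n \<Longrightarrow> norm (real (m n) * log 2 (real n)) \<le> B * norm (real n)"
    by (auto simp: eventually_sequentially)
  have "m n * a \<le> (N + nat \<lceil>B\<rceil>) * n" if a: "2 ^ a \<le> n" for n a
  proof (cases "N \<le> n")
    case True
    have "real a \<le> log 2 (real n)" using le_log2_of_power[OF a] .
    then have "real (m n) * real a \<le> real (m n) * log 2 (real n)" by (intro mult_left_mono) auto
    also have "\<dots> \<le> B * real n" using N[OF True] by simp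
    also have "\<dots> \<le> real (N + nat \<lceil>B\<rceil>) * real n" by (intro mult_right_mono) linarith+
    finally have "real (m n * a) \<le> real ((N + nat \<lceil>B\<rceil>) * n)" by simp
    then show ?thesis by (simp only: of_nat_le_iff)
  next
    \<comment> \<open>Below the threshold, \<open>m n \<le> n\<close> and \<open>a < n < N\<close>
      suffice.\<close>
    case False
    have "a < n" using a less_exp[of a] by linarith
    then have "m n * a \<le> n * N" using False m_le by (intro mult_mono) auto
    then show ?thesis by (simp add: algebra_simps)
  qed
  then show ?thesis by blast
qed

text \<open>The logarithm is at least 1 and absorbs the linear terms: \<open>1 + 3 * c\<close> comes
  from the preprocessing and 18 from the phases.\<close>

lemma running_time_bound:
  assumes "2 \<le> n"
  shows "real (preprocessing_steps n c + 6 * n * Suc (last_phase n)) \<le>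
    real (3 * c + 19) * (real n * log 2 (real n))"
proof -
  define L where "L = log 2 (real n)"
  have L: "1 \<le> L" using assms by (simp add: L_def)
  have "real (last_phase n) \<le> L + 1" unfolding last_phase_def L_def[symmetric] using L by linarith
  \<comment> \<open>The number of phases is at most \<open>L + 2 \<le> 3 * L\<close>.\<close>
  then have "6 * (real (last_phase n) + 1) \<le> 6 * (3 * L)" using L by (intro mult_left_mono) linarith+
  then have "6 * (real (last_phase n) + 1) \<le> 18 * L" by simp
  moreover have "1 + 3 * real c \<le> (1 + 3 * real c) * L"
    using L mult_left_mono[of 1 L "1 + 3 * real c"] by simp
  ultimately have "1 + 3 * real c + 6 * (real (last_phase n) + 1) \<le> real (3 * c + 19) * L"
    by (simp add: algebra_simps)
  then have "real n * (1 + 3 * real c + 6 * (real (last_phase n) + 1)) \<le>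
      real n * (real (3 * c + 19) * L)"
    by (intro mult_left_mono) auto
  then show ?thesis by (simp add: preprocessing_steps_def L_def[symmetric] algebra_simps)
qed

text \<open>Both constants are computed from \<open>D\<close>, which depends only on the sizes
  \<open>m\<close>; the tree, the labels and \<open>pick\<close> come afterwards, so the bound is
  uniform.\<close>

theorem theorem3:
  fixes m :: "nat \<Rightarrow> nat" and F :: "nat \<Rightarrow> nat \<Rightarrow> nat set"
  assumes "\<And>n. n \<ge> 1 \<Longrightarrow> strong_selective_family n (kappa n) (m n) (F n)"
    and "\<And>n. m n \<le> n"
    and "(\<lambda>n. real (m n)) \<in> O(\<lambda>n. (real (kappa n))\<^sup>2 * log 2 (real n))"
  shows "\<exists>(c::nat) (C::real). \<forall>(V::'v set) E r lab pick n P.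
           rooted_tree V E r \<longrightarrow> labelling V lab \<longrightarrow> picks pick \<longrightarrow>
           n = card V \<longrightarrow> P = bnd_dtree n c (m n) (F n) pick \<longrightarrow>
             bounded_messages V E lab P \<and>
             (\<exists>T::nat. real T \<le> C * (real n * log 2 (real n)) \<and> gathered V E r lab P T)"
proof -
  obtain D where D: "\<And>n a. 2 ^ a \<le> n \<Longrightarrow> m n * a \<le> D * n"
    using selector_size_times_log[of m] assms(2,3) by blast
  \<comment> \<open>The factor from \<open>activation_bound\<close>: with it the budget of
    \<open>c * n\<close> rounds suffices to activate every node.\<close>
  let ?c = "2 * D + 5"
  have "bounded_messages V E lab (bnd_dtree n ?c (m n) (F n) pick) \<and>
      (\<exists>T::nat. real T \<le> real (3 * ?c + 19) * (real n * log 2 (real n)) \<and>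
        gathered V E r lab (bnd_dtree n ?c (m n) (F n) pick) T)"
    if tree: "rooted_tree V E r" "labelling V lab" and pick: "picks pick" and n: "n = card V"
    for V :: "'v set" and E r lab pick n
  proof -
    interpret labelled_tree V E r lab n
      using tree n by unfold_locales
    interpret preprocessing_run V E r lab n "m n" "kappa n" "F n"
      using assms(1)[of n] kappa_pos[OF n_pos] n_pos by unfold_locales simp_all
    interpret bnd_dtree_run V E r lab n "m n" "kappa n" "F n" ?c pick
      using pick activation_bound[OF _ less_kappa_Suc_cubed D assms(2)] by unfold_locales
    have "\<exists>T::nat. real T \<le> real (3 * ?c + 19) * (real n * log 2 (real n)) \<and> gathered V E r lab prot T"
    proof (cases "2 \<le> n")
      case True
      then show ?thesis
        using running_time_bound[OF True, of ?c] gathered_end unfolding start_def by blast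
    next
      \<comment> \<open>For a single node the logarithm vanishes and the bound leaves only
        \<open>T = 0\<close>, when the root holds its own rumor.\<close>
      case False
      then have "n = 1" using n_pos by simp
      then have "V = {r}" using n r_in by (metis card_1_singletonE singletonD)
      then have "gathered V E r lab prot 0" by (simp add: gathered_def rumors_def)
      then show ?thesis using \<open>n = 1\<close> by (intro exI[of _ 0]) simp
    qed
    then show ?thesis using bounded by blast
  qed
  then show ?thesis by blast
qed

end
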